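(* The set $\{e_4^{\,i}e_6^{\,j}\delta^{k}\mid i,j,k\in\mathbb{Z}_{\ge0}\}$ is a $\mathbb{C}$-basis of $\mathcal{R}$.
   Context: Let $\mathrm{Hol}$ be the space of holomorphic functions on the upper half plane, $q=e^{2\pi iz}$, $f'=\frac{1}{2\pi i}\frac{df}{dz}$, and $E_2,E_4,E_6$ the Eisenstein series with constant term $1$. For $k\in\mathbb{R}$ let $D_kf=f'-\frac{k}{12}E_2f$. Let $H=\bigoplus_{n\in\mathbb{R}}H_n$ where each $H_n$ is a copy of $\mathrm{Hol}$, elements of $H_n$ being written $(f,n)$; $H$ is a graded commutative $\mathbb{C}$-algebra via $(f,n)(g,m)=(fg,n+m)$. Let $\mathrm{End}(H)=\bigoplus_{i\in\mathbb{R}}\mathrm{End}^i(H)$, where $\mathrm{End}^i(H)$ consists of the $\mathbb{C}$-linear maps $H\to H$ sending $H_n$ into $H_{n+i}$ for all $n$. Define $\delta,e_4,e_6\in\mathrm{End}(H)$ by $\delta(f,n)=(D_nf,n+2)$, $e_4(f,n)=(E_4f,n+4)$, $e_6(f,n)=(E_6f,n+6)$. $\mathcal{R}$ is the $\mathbb{C}$-subalgebra of $\mathrm{End}(H)$ generated by $\delta,e_4,e_6$. *)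

theory Defs
  imports "HOL-Analysis.Analysis"
begin

definition UHP :: "complex set" where
  "UHP = {z. Im z > 0}"

definition qexp :: "complex \<Rightarrow> complex" where
  "qexp z = exp (2 * of_real pi * \<i> * z)"

definition dsigma :: "nat \<Rightarrow> nat \<Rightarrow> complex" where
  "dsigma k n = (\<Sum>d\<in>{d. d dvd n}. of_nat d ^ k)"

definition Eis2 :: "complex \<Rightarrow> complex" where
  "Eis2 z = 1 - 24 * (\<Sum>n. dsigma 1 (Suc n) * qexp z ^ Suc n)"

definition Eis4 :: "complex \<Rightarrow> complex" where
  "Eis4 z = 1 + 240 * (\<Sum>n. dsigma 3 (Suc n) * qexp z ^ Suc n)"

definition Eis6 :: "complex \<Rightarrow> complex" where
  "Eis6 z = 1 - 504 * (\<Sum>n. dsigma 5 (Suc n) * qexp z ^ Suc n)"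

definition dq :: "(complex \<Rightarrow> complex) \<Rightarrow> complex \<Rightarrow> complex" where
  "dq f z = deriv f z / (2 * of_real pi * \<i>)"

definition Dop :: "real \<Rightarrow> (complex \<Rightarrow> complex) \<Rightarrow> complex \<Rightarrow> complex" where
  "Dop k f z = dq f z - of_real k / 12 * Eis2 z * f z"

text \<open>An element of H = direct sum over n in R of copies of Hol is represented by its
  family of components F n (finitely many nonzero), each holomorphic on the upper half
  plane; values off the upper half plane are normalised to 0.\<close>
type_synonym gfun = "real \<Rightarrow> complex \<Rightarrow> complex"

definition Hset :: "gfun set" where
  "Hset = {F. finite {n. F n \<noteq> (\<lambda>_. 0)} \<and>
              (\<forall>n. F n holomorphic_on UHP \<and> (\<forall>z. z \<notin> UHP \<longrightarrow> F n z = 0))}"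

text \<open>delta (f,n) = (D_n f, n+2), e4 (f,n) = (E4 f, n+4), e6 (f,n) = (E6 f, n+6).\<close>
definition delta_op :: "gfun \<Rightarrow> gfun" where
  "delta_op F = (\<lambda>m z. if z \<in> UHP then Dop (m - 2) (F (m - 2)) z else 0)"

definition e4_op :: "gfun \<Rightarrow> gfun" where
  "e4_op F = (\<lambda>m z. if z \<in> UHP then Eis4 z * F (m - 4) z else 0)"

definition e6_op :: "gfun \<Rightarrow> gfun" where
  "e6_op F = (\<lambda>m z. if z \<in> UHP then Eis6 z * F (m - 6) z else 0)"

inductive_set Ralg :: "(gfun \<Rightarrow> gfun) set" where
  R_id: "id \<in> Ralg"
| R_delta: "delta_op \<in> Ralg"
| R_e4: "e4_op \<in> Ralg"
| R_e6: "e6_op \<in> Ralg"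
| R_add: "A \<in> Ralg \<Longrightarrow> B \<in> Ralg \<Longrightarrow> (\<lambda>F m z. A F m z + B F m z) \<in> Ralg"
| R_smult: "A \<in> Ralg \<Longrightarrow> (\<lambda>F m z. c * A F m z) \<in> Ralg"
| R_comp: "A \<in> Ralg \<Longrightarrow> B \<in> Ralg \<Longrightarrow> A \<circ> B \<in> Ralg"

definition mono :: "nat \<times> nat \<times> nat \<Rightarrow> gfun \<Rightarrow> gfun" where
  "mono t = (case t of (i, j, k) \<Rightarrow> (e4_op ^^ i) \<circ> (e6_op ^^ j) \<circ> (delta_op ^^ k))"

end

theory Submission
  imports Defs "HOL-Complex_Analysis.Complex_Analysis"
begin

text \<open>Ramanujan's identities \<open>D\<^sub>4 E\<^sub>4 = -E\<^sub>6/3\<close> and \<open>D\<^sub>6 E\<^sub>6 = -E\<^sub>4\<^sup>2/2\<close> give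
  \<open>\<delta> e\<^sub>4 = e\<^sub>4 \<delta> - e\<^sub>6/3\<close> and \<open>\<delta> e\<^sub>6 = e\<^sub>6 \<delta> - e\<^sub>4\<^sup>2/2\<close>, so the span of the monomials is stable under left
  multiplication by the generators.  The identities are equivalent to evaluations of convolution
  sums of divisor functions, which are obtained from the bijection
  \<open>(a, b, x, y) \<mapsto> (a + b, b, x, y - x)\<close> on the positive solutions of \<open>a x + b y = n\<close>.
  For independence, a relation whose highest power of \<open>\<delta>\<close> is \<open>K\<close> is applied to \<open>(z - w)\<^sup>K\<close> in degree 0
  and evaluated at \<open>w\<close>; only the terms with \<open>\<delta>\<^sup>K\<close> survive, and they give a relation between the
  monomials in \<open>E\<^sub>4\<close> and \<open>E\<^sub>6\<close> of one weight.\<close>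

section \<open>Liouville's method for divisor sums\<close>

definition quads :: "nat \<Rightarrow> (nat \<times> nat \<times> nat \<times> nat) set" where
  "quads n = {(a, b, x, y). 0 < a \<and> 0 < b \<and> 0 < x \<and> 0 < y \<and> a * x + b * y = n}"

lemma finite_quads [simp, intro]: "finite (quads n)"
proof (rule finite_subset)
  show "quads n \<subseteq> {..n} \<times> {..n} \<times> {..n} \<times> {..n}"
  proof (clarsimp simp: quads_def)
    fix a b x y :: nat assume *: "0 < a" "0 < b" "0 < x" "0 < y"
    have "a \<le> a * x" "x \<le> a * x" "b \<le> b * y" "y \<le> b * y" using * by auto
    then show "a \<le> a * x + b * y \<and> b \<le> a * x + b * y \<and> x \<le> a * x + b * y \<and> y \<le> a * x + b * y"
      by linarith
  qed
qed auto

lemma sum_quads_swap: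
  "(\<Sum>(a, b, x, y) | (a, b, x, y) \<in> quads n \<and> P a b x y. f a b x y) =
   (\<Sum>(a, b, x, y) | (a, b, x, y) \<in> quads n \<and> P b a y x. f b a y x)"
  by (rule sum.reindex_bij_witness[of _ "\<lambda>(a, b, x, y). (b, a, y, x)" "\<lambda>(a, b, x, y). (b, a, y, x)"])
     (auto simp: quads_def algebra_simps)

text \<open>Trichotomy. \<open>u\<close> and \<open>v\<close> stay arbitrary because both
  \<open>x\<close> with \<open>y\<close> and \<open>a\<close> with \<open>b\<close> are compared
  later.\<close>

lemma sum_quads_split:
  fixes f :: "nat \<Rightarrow> nat \<Rightarrow> nat \<Rightarrow> nat \<Rightarrow> 'b::comm_monoid_add" and u v :: "nat \<Rightarrow> nat \<Rightarrow> nat \<Rightarrow> nat \<Rightarrow> nat"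
  shows "(\<Sum>(a, b, x, y)\<in>quads n. f a b x y) =
    (\<Sum>(a, b, x, y) | (a, b, x, y) \<in> quads n \<and> u a b x y < v a b x y. f a b x y) +
    (\<Sum>(a, b, x, y) | (a, b, x, y) \<in> quads n \<and> v a b x y < u a b x y. f a b x y) +
    (\<Sum>(a, b, x, y) | (a, b, x, y) \<in> quads n \<and> u a b x y = v a b x y. f a b x y)"
proof -
  let ?A = "{(a, b, x, y). (a, b, x, y) \<in> quads n \<and> u a b x y < v a b x y}"
  let ?B = "{(a, b, x, y). (a, b, x, y) \<in> quads n \<and> v a b x y < u a b x y}"
  let ?C = "{(a, b, x, y). (a, b, x, y) \<in> quads n \<and> u a b x y = v a b x y}"
  have fin: "finite ?A" "finite ?B" "finite ?C"
    by (rule finite_subset[OF _ finite_quads[of n]]; auto)+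
  have "quads n = ?A \<union> ?B \<union> ?C" by force
  then have "(\<Sum>(a, b, x, y)\<in>quads n. f a b x y) = (\<Sum>(a, b, x, y)\<in>?A \<union> ?B \<union> ?C. f a b x y)"
    by metis
  also have "\<dots> = (\<Sum>(a, b, x, y)\<in>?A. f a b x y) + (\<Sum>(a, b, x, y)\<in>?B. f a b x y)
      + (\<Sum>(a, b, x, y)\<in>?C. f a b x y)"
    by (subst sum.union_disjoint; (use fin in auto)?)+
  finally show ?thesis .
qed

text \<open>By a x + b y = (a + b) x + b (y - x) the shear keeps n fixed, and it maps the solutions
  with x < y bijectively onto those with b < a.\<close>

lemma sum_quads_shear:
  fixes h :: "nat \<Rightarrow> nat \<Rightarrow> 'b::comm_monoid_add"
  shows "(\<Sum>(a, b, x, y) | (a, b, x, y) \<in> quads n \<and> x < y. h (a + b) b) =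
         (\<Sum>(a, b, x, y) | (a, b, x, y) \<in> quads n \<and> b < a. h a b)"
  by (rule sum.reindex_bij_witness[of _ "\<lambda>(a, b, x, y). (a - b, b, x, x + y)" "\<lambda>(a, b, x, y). (a + b, b, x, y - x)"])
     (auto simp: quads_def algebra_simps elim!: less_natE)

lemma nat_mult_add_diff:
  "(a + b) * k - b * k = a * k" "k * (a + b) - k * a = k * b" for a b k :: nat
  by (simp_all add: algebra_simps)

text \<open>For x = y the equation reads (a + b) x = n: d = a + b is a divisor of n, and b takes the
  values strictly between 0 and d.\<close>

lemma sum_quads_diag_right:
  fixes f :: "nat \<Rightarrow> nat \<Rightarrow> 'b::comm_monoid_add"
  assumes "n > 0"
  shows "(\<Sum>(a, b, x, y) | (a, b, x, y) \<in> quads n \<and> x = y. f (a + b) b) =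
         (\<Sum>d | d dvd n. \<Sum>b\<in>{1..<d}. f d b)"
proof -
  have "(\<Sum>d | d dvd n. \<Sum>b\<in>{1..<d}. f d b) = (\<Sum>(d, b)\<in>(SIGMA d:{d. d dvd n}. {1..<d}). f d b)"
    using assms by (subst sum.Sigma) auto
  also have "\<dots> = (\<Sum>(a, b, x, y) | (a, b, x, y) \<in> quads n \<and> x = y. f (a + b) b)"
    by (rule sum.reindex_bij_witness[of _ "\<lambda>(a, b, x, y). (a + b, b)" "\<lambda>(d, b). (d - b, b, n div d, n div d)"])
       (use assms in \<open>auto simp: quads_def dvd_def diff_mult_distrib nat_mult_add_diff simp flip: distrib_right\<close>)
  finally show ?thesis ..
qed

text \<open>For a = b the equation reads a (x + y) = n: the divisor d = a leaves
  \<open>n div d - 1\<close> choices for x.\<close>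

lemma sum_quads_diag_left:
  fixes f :: "nat \<Rightarrow> 'b::comm_semiring_1"
  assumes "n > 0"
  shows "(\<Sum>(a, b, x, y) | (a, b, x, y) \<in> quads n \<and> a = b. f a) =
         (\<Sum>d | d dvd n. of_nat (n div d - 1) * f d)"
proof -
  have "(\<Sum>d | d dvd n. of_nat (n div d - 1) * f d) = (\<Sum>d | d dvd n. \<Sum>x\<in>{1..<n div d}. f d)"
    by simp
  also have "\<dots> = (\<Sum>(d, x)\<in>(SIGMA d:{d. d dvd n}. {1..<n div d}). f d)"
    using assms by (subst sum.Sigma) auto
  also have "\<dots> = (\<Sum>(a, b, x, y) | (a, b, x, y) \<in> quads n \<and> a = b. f a)"
    by (rule sum.reindex_bij_witness[of _ "\<lambda>(a, b, x, y). (a, x)" "\<lambda>(d, x). (d, d, x, n div d - x)"])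
       (use assms in \<open>auto simp: quads_def dvd_def diff_mult_distrib2 nat_mult_add_diff simp flip: distrib_left\<close>)
  finally show ?thesis ..
qed

text \<open>The shear sends the terms \<open>h (a + b) b\<close> with \<open>x < y\<close> to \<open>h a b\<close> with \<open>b < a\<close>, and those with
  \<open>y < x\<close>, after exchanging \<open>(a, x)\<close> and \<open>(b, y)\<close>, to \<open>h a (a - b)\<close>; symmetry of \<open>k\<close> then removes the
  restriction \<open>b < a\<close>.\<close>
lemma liouville:
  fixes h :: "complex \<Rightarrow> complex \<Rightarrow> complex"
  assumes n: "n > 0" and k: "\<And>a b. k a b = h a b + h a (a - b)" and sym: "\<And>a b. k a b = k b a"
  shows "(\<Sum>(a, b, x, y)\<in>quads n. 2 * h (of_nat a + of_nat b) (of_nat b) - k (of_nat a) (of_nat b)) =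
    (\<Sum>d | d dvd n. 2 * (\<Sum>b\<in>{1..<d}. h (of_nat d) (of_nat b)) -
      of_nat (n div d - 1) * k (of_nat d) (of_nat d))"
proof -
  let ?h = "\<lambda>a b. h (of_nat a) (of_nat b)"
  let ?k = "\<lambda>a b. k (of_nat a) (of_nat b)"
  have "(\<Sum>(a, b, x, y) | (a, b, x, y) \<in> quads n \<and> y < x. ?h (a + b) b) =
        (\<Sum>(a, b, x, y) | (a, b, x, y) \<in> quads n \<and> x < y. ?h (a + b) a)"
    by (subst sum_quads_swap) (simp add: add.commute)
  \<comment> \<open>Writing a as (a + b) - b makes the summand a function of a + b and b, as the
    shear requires.\<close>
  also have "\<dots> = (\<Sum>(a, b, x, y) | (a, b, x, y) \<in> quads n \<and> x < y. ?h (a + b) ((a + b) - b))"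
    by simp
  also have "\<dots> = (\<Sum>(a, b, x, y) | (a, b, x, y) \<in> quads n \<and> b < a. ?h a (a - b))"
    by (rule sum_quads_shear)
  also have "\<dots> = (\<Sum>(a, b, x, y) | (a, b, x, y) \<in> quads n \<and> b < a. h (of_nat a) (of_nat a - of_nat b))"
    by (rule sum.cong) (auto simp: of_nat_diff)
  finally have gt: "(\<Sum>(a, b, x, y) | (a, b, x, y) \<in> quads n \<and> y < x. ?h (a + b) b) = \<dots>" .
  have H: "(\<Sum>(a, b, x, y)\<in>quads n. ?h (a + b) b) =
     (\<Sum>(a, b, x, y) | (a, b, x, y) \<in> quads n \<and> b < a. ?k a b) +
     (\<Sum>(a, b, x, y) | (a, b, x, y) \<in> quads n \<and> x = y. ?h (a + b) b)"
    unfolding sum_quads_split[where u = "\<lambda>a b x y. x" and v = "\<lambda>a b x y. y"] gt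
      sum_quads_shear[where h = ?h] k
    by (simp add: sum.distrib case_prod_unfold)
  have "(\<Sum>(a, b, x, y) | (a, b, x, y) \<in> quads n \<and> a < b. ?k a b) =
        (\<Sum>(a, b, x, y) | (a, b, x, y) \<in> quads n \<and> b < a. ?k a b)"
    by (subst sum_quads_swap) (subst sym, rule refl)
  then have K: "(\<Sum>(a, b, x, y)\<in>quads n. ?k a b) =
     2 * (\<Sum>(a, b, x, y) | (a, b, x, y) \<in> quads n \<and> b < a. ?k a b) +
     (\<Sum>(a, b, x, y) | (a, b, x, y) \<in> quads n \<and> a = b. ?k a b)"
    unfolding sum_quads_split[where u = "\<lambda>a b x y. a" and v = "\<lambda>a b x y. b"] by simp
  have d: "(\<Sum>(a, b, x, y) | (a, b, x, y) \<in> quads n \<and> a = b. ?k a b) =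
        (\<Sum>(a, b, x, y) | (a, b, x, y) \<in> quads n \<and> a = b. ?k a a)"
    by (rule sum.cong) auto
  have "(\<Sum>(a, b, x, y)\<in>quads n. 2 * h (of_nat a + of_nat b) (of_nat b) - ?k a b) =
      2 * (\<Sum>(a, b, x, y)\<in>quads n. ?h (a + b) b) - (\<Sum>(a, b, x, y)\<in>quads n. ?k a b)"
    by (simp add: sum_subtractf sum_distrib_left case_prod_unfold)
  \<comment> \<open>The sums of \<open>?k\<close> over b < a cancel. The two diagonals survive, and
    these are sums over divisors.\<close>
  also have "\<dots> = 2 * (\<Sum>(a, b, x, y) | (a, b, x, y) \<in> quads n \<and> x = y. ?h (a + b) b) -
     (\<Sum>(a, b, x, y) | (a, b, x, y) \<in> quads n \<and> a = b. ?k a a)"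
    unfolding H K d by simp
  finally show ?thesis
    unfolding sum_quads_diag_right[OF n, where f = ?h] sum_quads_diag_left[OF n, where f = "\<lambda>a. ?k a a"]
    by (simp add: sum_subtractf sum_distrib_left)
qed

text \<open>Every natural number divides 0 and sums over infinite sets are 0.\<close>
lemma dsigma_0 [simp]: "dsigma k 0 = 0"
  by (simp add: dsigma_def)

section \<open>Convolution sums of divisor functions\<close>

definition sigma_fps :: "nat \<Rightarrow> complex fps" where
  "sigma_fps k = Abs_fps (dsigma k)"

text \<open>Solutions are grouped by m = a x. Then b y = n - m, so a and b are divisors of m and n -
  m, and they determine x and y. The terms m = 0 and m = n of the Cauchy product vanish because
  \<open>dsigma\<close> is 0 at 0.\<close>

lemma sum_quads_dsigma:
  assumes "n > 0"
  shows "(\<Sum>(a, b, x, y)\<in>quads n. of_nat a ^ r * of_nat b ^ s) =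
         fps_nth (sigma_fps r * sigma_fps s) n"
proof -
  have "fps_nth (sigma_fps r * sigma_fps s) n = (\<Sum>m\<in>{0..n}. dsigma r m * dsigma s (n - m))"
    by (simp add: sigma_fps_def fps_mult_nth)
  also have "\<dots> = (\<Sum>m\<in>{1..<n}. dsigma r m * dsigma s (n - m))"
    by (rule sum.mono_neutral_right) (auto simp: not_le not_less)
  also have "\<dots> = (\<Sum>m\<in>{1..<n}. \<Sum>(a, b)\<in>{d. d dvd m} \<times> {d. d dvd n - m}. of_nat a ^ r * of_nat b ^ s)"
    by (simp add: dsigma_def sum_product sum.cartesian_product)
  also have "\<dots> = (\<Sum>(m, a, b)\<in>(SIGMA m:{1..<n}. {d. d dvd m} \<times> {d. d dvd n - m}). of_nat a ^ r * of_nat b ^ s)"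
    by (subst sum.Sigma) (auto simp: case_prod_unfold intro!: finite_cartesian_product)
  also have "\<dots> = (\<Sum>(a, b, x, y)\<in>quads n. of_nat a ^ r * of_nat b ^ s)"
    by (rule sum.reindex_bij_witness[of _ "\<lambda>(a, b, x, y). (a * x, a, b)" "\<lambda>(m, a, b). (a, b, m div a, (n - m) div b)"])
       (auto simp: quads_def dvd_div_eq_0_iff intro!: Nat.gr0I)
  finally show ?thesis ..
qed

text \<open>At d = 0 both index sets are empty and the extra summand is \<open>0 ^ p\<close>, hence
  the condition on p.\<close>

lemma sum_power_Suc:
  assumes "p > 0"
  shows "(\<Sum>b\<in>{1..<Suc d}. of_nat b ^ p) = (\<Sum>b\<in>{1..<d}. of_nat b ^ p) + (of_nat d :: complex) ^ p"
  using assms by (cases d) auto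

text \<open>This and the next two are Faulhaber's formulas; excluding the upper bound makes the
  second coefficient negative.\<close>

lemma sum_power_2: "(\<Sum>b\<in>{1..<d}. of_nat b ^ 2) =
  (of_nat d ^ 3 / 3 - of_nat d ^ 2 / 2 + of_nat d / 6 :: complex)"
proof (induction d)
  case (Suc d)
  show ?case
    unfolding sum_power_Suc[OF zero_less_numeral] Suc
    by (simp add: field_simps eval_nat_numeral)
qed simp

lemma sum_power_4: "(\<Sum>b\<in>{1..<d}. of_nat b ^ 4) =
  (of_nat d ^ 5 / 5 - of_nat d ^ 4 / 2 + of_nat d ^ 3 / 3 - of_nat d / 30 :: complex)"
proof (induction d)
  case (Suc d)
  show ?case
    unfolding sum_power_Suc[OF zero_less_numeral] Suc
    by (simp add: field_simps eval_nat_numeral)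
qed simp

lemma sum_power_6: "(\<Sum>b\<in>{1..<d}. of_nat b ^ 6) =
  (of_nat d ^ 7 / 7 - of_nat d ^ 6 / 2 + of_nat d ^ 5 / 2 - of_nat d ^ 3 / 6 + of_nat d / 42 :: complex)"
proof (induction d)
  case (Suc d)
  show ?case
    unfolding sum_power_Suc[OF zero_less_numeral] Suc
    by (simp add: field_simps eval_nat_numeral)
qed simp

text \<open>Since \<open>d * (n div d) = n\<close>, the multiplicity on the diagonal a = b turns
  into the factor n that later becomes a derivative.\<close>

lemma of_nat_quotient_pred:
  assumes "d dvd n" "n > 0"
  shows "of_nat (n div d - 1) * (of_nat d :: complex) ^ Suc w = of_nat n * of_nat d ^ w - of_nat d ^ Suc w"
proof -
  obtain e where e: "n = d * e" using assms by auto
  with assms have "d > 0" "e > 0" by (auto intro: Nat.gr0I)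
  then show ?thesis by (simp add: e of_nat_diff algebra_simps)
qed

text \<open>Isolates an unknown convolution \<open>c\<close> from an identity in which it occurs
  linearly.\<close>

lemma solve_linear_eq: "k \<noteq> 0 \<Longrightarrow> r = k * c + e \<Longrightarrow> c = (r - e) / k" for k c e r :: complex
  by (auto simp: field_simps)

text \<open>The polynomials \<open>h\<close> below are chosen so that \<open>k\<close> is symmetric and, after symmetrization,
  only monomials with odd exponents in \<open>a\<close> and \<open>b\<close> remain on the left of the identity.\<close>
lemma sigma_conv_1_3:
  "fps_nth (sigma_fps 1 * sigma_fps 3) n =
    (21 * dsigma 5 n + 10 * dsigma 3 n - dsigma 1 n - 30 * of_nat n * dsigma 3 n) / 240"
proof (cases "n = 0")
  case False
  then have n: "n > 0" by simp
  \<comment> \<open>The values at b and a - b add up to b^4 + (a - b)^4 + a^4; the summand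
    \<open>u ^ 4 / 2\<close>, counted twice, supplies the a^4 that symmetry requires.\<close>
  define h :: "complex \<Rightarrow> complex \<Rightarrow> complex" where "h = (\<lambda>u v. v ^ 4 + u ^ 4 / 2)"
  define k :: "complex \<Rightarrow> complex \<Rightarrow> complex" where "k = (\<lambda>u v. u ^ 4 + v ^ 4 + (u - v) ^ 4)"
  let ?c = "\<lambda>r s. fps_nth (sigma_fps r * sigma_fps s) n"
  have c: "?c 4 0 = ?c 0 4" "?c 3 1 = ?c 1 3" by (simp_all add: mult.commute)
  have "2 * h (a + b) b - k a b = 8 * (a ^ 3 * b ^ 1) + 8 * (a ^ 1 * b ^ 3) + a ^ 0 * b ^ 4 - a ^ 4 * b ^ 0" for a b
    unfolding h_def k_def by (simp add: field_simps eval_nat_numeral)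
  then have "(\<Sum>(a, b, x, y)\<in>quads n. 2 * h (of_nat a + of_nat b) (of_nat b) - k (of_nat a) (of_nat b)) =
      8 * ?c 3 1 + 8 * ?c 1 3 + ?c 0 4 - ?c 4 0"
    unfolding sum_quads_dsigma[OF n, symmetric]
    by (simp only: sum_distrib_left sum.distrib sum_subtractf case_prod_unfold)
  \<comment> \<open>The terms with exponents 0 and 4 cancel by commutativity; \<open>+ 0\<close>
    fits the shape of \<open>solve_linear_eq\<close>.\<close>
  also have "\<dots> = 16 * ?c 1 3 + 0" using c by simp
  \<comment> \<open>This rewrites the left side of the chain, which therefore ends in a linear
    equation for \<open>?c 1 3\<close>.\<close>
  also have "(\<Sum>(a, b, x, y)\<in>quads n. 2 * h (of_nat a + of_nat b) (of_nat b) - k (of_nat a) (of_nat b)) =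
      (\<Sum>d | d dvd n. 2 * (\<Sum>b\<in>{1..<d}. h (of_nat d) (of_nat b)) - of_nat (n div d - 1) * k (of_nat d) (of_nat d))"
  proof (rule liouville[OF n])
    show "k a b = h a b + h a (a - b)" for a b unfolding h_def k_def by (simp add: field_simps eval_nat_numeral)
    show "k a b = k b a" for a b unfolding h_def k_def by (simp add: field_simps eval_nat_numeral)
  qed
  also have "\<dots> = (\<Sum>d | d dvd n. 7 / 5 * of_nat d ^ 5 + 2 / 3 * of_nat d ^ 3 - 1 / 15 * of_nat d ^ 1 - 2 * (of_nat n * of_nat d ^ 3))"
  proof (rule sum.cong[OF refl], clarify)
    fix d assume d: "d dvd n"
    with n have d0: "d > 0" by (auto intro: Nat.gr0I)
    have hs: "(\<Sum>b\<in>{1..<d}. h (of_nat d) (of_nat b)) = (\<Sum>b\<in>{1..<d}. of_nat b ^ 4) + of_nat (d - 1) * of_nat d ^ 4 / 2"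
      by (simp add: h_def sum.distrib sum_subtractf sum_distrib_left)
    have ks: "of_nat (n div d - 1) * k (of_nat d) (of_nat d) = 2 * (of_nat n * of_nat d ^ 3 - of_nat d ^ 4)"
    proof -
      have "of_nat (n div d - 1) * k (of_nat d) (of_nat d) = 2 * (of_nat (n div d - 1) * of_nat d ^ Suc 3)"
        by (simp add: k_def)
      then show ?thesis unfolding of_nat_quotient_pred[OF d n] by simp
    qed
    show "2 * (\<Sum>b\<in>{1..<d}. h (of_nat d) (of_nat b)) - of_nat (n div d - 1) * k (of_nat d) (of_nat d) =
        7 / 5 * of_nat d ^ 5 + 2 / 3 * of_nat d ^ 3 - 1 / 15 * of_nat d ^ 1 - 2 * (of_nat n * of_nat d ^ 3)"
      using d0 unfolding hs ks sum_power_4 by (simp add: of_nat_diff field_simps eval_nat_numeral)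
  qed
  also have "\<dots> = 7 / 5 * dsigma 5 n + 2 / 3 * dsigma 3 n - 1 / 15 * dsigma 1 n - 2 * (of_nat n * dsigma 3 n)"
    unfolding dsigma_def by (simp only: sum_distrib_left sum.distrib sum_subtractf)
  finally have eq: "?c 1 3 =
      (7 / 5 * dsigma 5 n + 2 / 3 * dsigma 3 n - 1 / 15 * dsigma 1 n - 2 * (of_nat n * dsigma 3 n) - 0) / 16"
    by (rule solve_linear_eq[rotated]) simp
  show ?thesis unfolding eq by (simp add: field_simps)
qed (simp add: sigma_fps_def)

text \<open>This is E_4^2 = E_8 on coefficients, where E_8 is 1 plus 480 times the series with
  coefficients \<open>dsigma 7\<close>. It serves both for the square of E_4 and for eliminating a
  convolution in the next lemma.\<close>

lemma sigma_conv_3_3: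
  "fps_nth (sigma_fps 3 * sigma_fps 3) n = (dsigma 7 n - dsigma 3 n) / 120"
proof (cases "n = 0")
  case False
  then have n: "n > 0" by simp
  define h :: "complex \<Rightarrow> complex \<Rightarrow> complex" where "h = (\<lambda>u v. u ^ 6 - 4 * u ^ 4 * v ^ 2 + 2 * u ^ 2 * v ^ 4)"
  \<comment> \<open>\<open>k\<close> expands to \<open>4 * u ^ 2 * v ^ 2 * (u - v) ^ 2\<close>: it
    is symmetric and vanishes on the diagonal, so no term with the factor n arises.\<close>
  define k :: "complex \<Rightarrow> complex \<Rightarrow> complex" where "k = (\<lambda>u v. h u v + h u (u - v))"
  let ?c = "\<lambda>r s. fps_nth (sigma_fps r * sigma_fps s) n"
  have c: "?c 6 0 = ?c 0 6" "?c 5 1 = ?c 1 5" "?c 4 2 = ?c 2 4" by (simp_all add: mult.commute)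
  have "2 * h (a + b) b - k a b = - 2 * (a ^ 0 * b ^ 6) - 12 * (a ^ 1 * b ^ 5) - 18 * (a ^ 2 * b ^ 4) + 16 * (a ^ 3 * b ^ 3) + 18 * (a ^ 4 * b ^ 2) + 12 * (a ^ 5 * b ^ 1) + 2 * (a ^ 6 * b ^ 0)" for a b
    unfolding h_def k_def by (simp add: field_simps eval_nat_numeral)
  then have "(\<Sum>(a, b, x, y)\<in>quads n. 2 * h (of_nat a + of_nat b) (of_nat b) - k (of_nat a) (of_nat b)) =
      - 2 * ?c 0 6 - 12 * ?c 1 5 - 18 * ?c 2 4 + 16 * ?c 3 3 + 18 * ?c 4 2 + 12 * ?c 5 1 + 2 * ?c 6 0"
    unfolding sum_quads_dsigma[OF n, symmetric]
    by (simp only: sum_distrib_left sum.distrib sum_subtractf case_prod_unfold)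
  \<comment> \<open>All terms except \<open>?c 3 3\<close> occur in pairs of opposite sign.\<close>
  also have "\<dots> = 16 * ?c 3 3 + 0" using c by simp
  also have "(\<Sum>(a, b, x, y)\<in>quads n. 2 * h (of_nat a + of_nat b) (of_nat b) - k (of_nat a) (of_nat b)) =
      (\<Sum>d | d dvd n. 2 * (\<Sum>b\<in>{1..<d}. h (of_nat d) (of_nat b)) - of_nat (n div d - 1) * k (of_nat d) (of_nat d))"
  proof (rule liouville[OF n])
    show "k a b = h a b + h a (a - b)" for a b unfolding h_def k_def by (simp add: field_simps eval_nat_numeral)
    show "k a b = k b a" for a b unfolding h_def k_def by (simp add: field_simps eval_nat_numeral)
  qed
  also have "\<dots> = (\<Sum>d | d dvd n. 2 / 15 * of_nat d ^ 7 - 2 / 15 * of_nat d ^ 3)"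
  proof (rule sum.cong[OF refl], clarify)
    fix d assume d: "d dvd n"
    with n have d0: "d > 0" by (auto intro: Nat.gr0I)
    have hs: "(\<Sum>b\<in>{1..<d}. h (of_nat d) (of_nat b)) = of_nat (d - 1) * of_nat d ^ 6 - 4 * of_nat d ^ 4 * (\<Sum>b\<in>{1..<d}. of_nat b ^ 2) + 2 * of_nat d ^ 2 * (\<Sum>b\<in>{1..<d}. of_nat b ^ 4)"
      by (simp add: h_def sum.distrib sum_subtractf sum_distrib_left)
    have ks: "of_nat (n div d - 1) * k (of_nat d) (of_nat d) = 0"
      by (simp add: h_def k_def)
    show "2 * (\<Sum>b\<in>{1..<d}. h (of_nat d) (of_nat b)) - of_nat (n div d - 1) * k (of_nat d) (of_nat d) =
        2 / 15 * of_nat d ^ 7 - 2 / 15 * of_nat d ^ 3"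
      using d0 unfolding hs ks sum_power_2 sum_power_4 by (simp add: of_nat_diff field_simps eval_nat_numeral)
  qed
  also have "\<dots> = 2 / 15 * dsigma 7 n - 2 / 15 * dsigma 3 n"
    unfolding dsigma_def by (simp only: sum_distrib_left sum.distrib sum_subtractf)
  finally have eq: "?c 3 3 =
      (2 / 15 * dsigma 7 n - 2 / 15 * dsigma 3 n - 0) / 16"
    by (rule solve_linear_eq[rotated]) simp
  show ?thesis unfolding eq by (simp add: field_simps)
qed (simp add: sigma_fps_def)

text \<open>The analogue with sixth powers of the choice for exponents 1 and 3 leaves two
  convolutions; \<open>sigma_conv_3_3\<close> eliminates one.\<close>

lemma sigma_conv_1_5:
  "fps_nth (sigma_fps 1 * sigma_fps 5) n =
    (20 * dsigma 7 n + 21 * dsigma 5 n + dsigma 1 n - 42 * of_nat n * dsigma 5 n) / 504"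
proof (cases "n = 0")
  case False
  then have n: "n > 0" by simp
  define h :: "complex \<Rightarrow> complex \<Rightarrow> complex" where "h = (\<lambda>u v. v ^ 6 + u ^ 6 / 2)"
  define k :: "complex \<Rightarrow> complex \<Rightarrow> complex" where "k = (\<lambda>u v. u ^ 6 + v ^ 6 + (u - v) ^ 6)"
  let ?c = "\<lambda>r s. fps_nth (sigma_fps r * sigma_fps s) n"
  have c: "?c 6 0 = ?c 0 6" "?c 5 1 = ?c 1 5" by (simp_all add: mult.commute)
  have "2 * h (a + b) b - k a b = 12 * (a ^ 5 * b ^ 1) + 40 * (a ^ 3 * b ^ 3) + 12 * (a ^ 1 * b ^ 5) + a ^ 0 * b ^ 6 - a ^ 6 * b ^ 0" for a b
    unfolding h_def k_def by (simp add: field_simps eval_nat_numeral)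
  then have "(\<Sum>(a, b, x, y)\<in>quads n. 2 * h (of_nat a + of_nat b) (of_nat b) - k (of_nat a) (of_nat b)) =
      12 * ?c 5 1 + 40 * ?c 3 3 + 12 * ?c 1 5 + ?c 0 6 - ?c 6 0"
    unfolding sum_quads_dsigma[OF n, symmetric]
    by (simp only: sum_distrib_left sum.distrib sum_subtractf case_prod_unfold)
  also have "\<dots> = 24 * ?c 1 5 + 40 * ?c 3 3" using c by simp
  also have "(\<Sum>(a, b, x, y)\<in>quads n. 2 * h (of_nat a + of_nat b) (of_nat b) - k (of_nat a) (of_nat b)) =
      (\<Sum>d | d dvd n. 2 * (\<Sum>b\<in>{1..<d}. h (of_nat d) (of_nat b)) - of_nat (n div d - 1) * k (of_nat d) (of_nat d))"
  proof (rule liouville[OF n])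
    show "k a b = h a b + h a (a - b)" for a b unfolding h_def k_def by (simp add: field_simps eval_nat_numeral)
    show "k a b = k b a" for a b unfolding h_def k_def by (simp add: field_simps eval_nat_numeral)
  qed
  also have "\<dots> = (\<Sum>d | d dvd n. 9 / 7 * of_nat d ^ 7 + of_nat d ^ 5 - 1 / 3 * of_nat d ^ 3 + 1 / 21 * of_nat d ^ 1 - 2 * (of_nat n * of_nat d ^ 5))"
  proof (rule sum.cong[OF refl], clarify)
    fix d assume d: "d dvd n"
    with n have d0: "d > 0" by (auto intro: Nat.gr0I)
    have hs: "(\<Sum>b\<in>{1..<d}. h (of_nat d) (of_nat b)) = (\<Sum>b\<in>{1..<d}. of_nat b ^ 6) + of_nat (d - 1) * of_nat d ^ 6 / 2"
      by (simp add: h_def sum.distrib sum_subtractf sum_distrib_left)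
    have ks: "of_nat (n div d - 1) * k (of_nat d) (of_nat d) = 2 * (of_nat n * of_nat d ^ 5 - of_nat d ^ 6)"
    proof -
      have "of_nat (n div d - 1) * k (of_nat d) (of_nat d) = 2 * (of_nat (n div d - 1) * of_nat d ^ Suc 5)"
        by (simp add: k_def)
      then show ?thesis unfolding of_nat_quotient_pred[OF d n] by simp
    qed
    show "2 * (\<Sum>b\<in>{1..<d}. h (of_nat d) (of_nat b)) - of_nat (n div d - 1) * k (of_nat d) (of_nat d) =
        9 / 7 * of_nat d ^ 7 + of_nat d ^ 5 - 1 / 3 * of_nat d ^ 3 + 1 / 21 * of_nat d ^ 1 - 2 * (of_nat n * of_nat d ^ 5)"
      using d0 unfolding hs ks sum_power_6 by (simp add: of_nat_diff field_simps eval_nat_numeral)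
  qed
  also have "\<dots> = 9 / 7 * dsigma 7 n + dsigma 5 n - 1 / 3 * dsigma 3 n + 1 / 21 * dsigma 1 n - 2 * (of_nat n * dsigma 5 n)"
    unfolding dsigma_def by (simp only: sum_distrib_left sum.distrib sum_subtractf)
  finally have eq: "?c 1 5 =
      (9 / 7 * dsigma 7 n + dsigma 5 n - 1 / 3 * dsigma 3 n + 1 / 21 * dsigma 1 n - 2 * (of_nat n * dsigma 5 n) - 40 * ?c 3 3) / 24"
    by (rule solve_linear_eq[rotated]) simp
  show ?thesis unfolding eq sigma_conv_3_3 by (simp add: field_simps)
qed (simp add: sigma_fps_def)


section \<open>Ramanujan's differential equations\<close>

definition E2_fps :: "complex fps" where "E2_fps = 1 - 24 * sigma_fps 1"
definition E4_fps :: "complex fps" where "E4_fps = 1 + 240 * sigma_fps 3"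
definition E6_fps :: "complex fps" where "E6_fps = 1 - 504 * sigma_fps 5"

text \<open>\<open>fps_XD\<close> is q d/dq and multiplies the n-th coefficient by n. This factor
  comes from \<open>sigma_conv_1_3\<close>; all its other terms cancel, as 5760 / 240 = 24.\<close>

lemma ramanujan_E4_fps: "3 * fps_XD E4_fps = E2_fps * E4_fps - E6_fps"
proof (rule fps_ext)
  fix n
  have "E2_fps * E4_fps - E6_fps = 240 * sigma_fps 3 - 24 * sigma_fps 1
      - 5760 * (sigma_fps 1 * sigma_fps 3) + 504 * sigma_fps 5"
    unfolding E2_fps_def E4_fps_def E6_fps_def by (simp add: algebra_simps)
  then have "fps_nth (E2_fps * E4_fps - E6_fps) n = 240 * dsigma 3 n - 24 * dsigma 1 n
      - 5760 * fps_nth (sigma_fps 1 * sigma_fps 3) n + 504 * dsigma 5 n"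
    by (simp add: numeral_fps_const sigma_fps_def)
  also have "\<dots> = 3 * (of_nat n * (240 * dsigma 3 n))"
    unfolding sigma_conv_1_3 by (simp add: field_simps)
  also have "\<dots> = fps_nth (3 * fps_XD E4_fps) n"
    by (cases "n = 0") (simp_all add: E4_fps_def numeral_fps_const sigma_fps_def)
  finally show "fps_nth (3 * fps_XD E4_fps) n = fps_nth (E2_fps * E4_fps - E6_fps) n" ..
qed

text \<open>The \<open>dsigma 7\<close> terms of the two convolution formulas cancel because 12096 *
  20 / 504 = 57600 / 120.\<close>

lemma ramanujan_E6_fps: "2 * fps_XD E6_fps = E2_fps * E6_fps - E4_fps * E4_fps"
proof (rule fps_ext)
  fix n
  have "E2_fps * E6_fps - E4_fps * E4_fps = 12096 * (sigma_fps 1 * sigma_fps 5)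
      - 57600 * (sigma_fps 3 * sigma_fps 3) - 504 * sigma_fps 5 - 24 * sigma_fps 1 - 480 * sigma_fps 3"
    unfolding E2_fps_def E4_fps_def E6_fps_def by (simp add: algebra_simps)
  then have "fps_nth (E2_fps * E6_fps - E4_fps * E4_fps) n =
      12096 * fps_nth (sigma_fps 1 * sigma_fps 5) n - 57600 * fps_nth (sigma_fps 3 * sigma_fps 3) n
      - 504 * dsigma 5 n - 24 * dsigma 1 n - 480 * dsigma 3 n"
    by (simp add: numeral_fps_const sigma_fps_def)
  also have "\<dots> = 2 * (of_nat n * (- 504 * dsigma 5 n))"
    unfolding sigma_conv_1_5 sigma_conv_3_3 by (simp add: field_simps)
  also have "\<dots> = fps_nth (2 * fps_XD E6_fps) n"
    by (cases "n = 0") (simp_all add: E6_fps_def numeral_fps_const sigma_fps_def)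
  finally show "fps_nth (2 * fps_XD E6_fps) n = fps_nth (E2_fps * E6_fps - E4_fps * E4_fps) n" ..
qed

section \<open>Convergence of the q-series and passage to functions on the upper half plane\<close>

lemma norm_dsigma_le: "norm (dsigma k n) \<le> real n ^ Suc k"
proof (cases "n = 0")
  case False
  have "norm (dsigma k n) \<le> (\<Sum>d | d dvd n. real d ^ k)"
    unfolding dsigma_def by (rule order_trans[OF norm_sum]) (simp add: norm_power)
  also have "\<dots> \<le> (\<Sum>d\<in>{1..n}. real d ^ k)"
    by (rule sum_mono2) (use False in \<open>auto dest: dvd_imp_le intro: Nat.gr0I\<close>)
  also have "\<dots> \<le> (\<Sum>d\<in>{1..n}. real n ^ k)"
    by (intro sum_mono power_mono) auto
  finally show ?thesis by simp
qed simp

text \<open>Comparison with the coefficients \<open>real n ^ Suc k\<close>, whose series has radius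
  1 by the ratio test.\<close>

lemma conv_radius_sigma_fps: "fps_conv_radius (sigma_fps k) \<ge> 1"
  unfolding fps_conv_radius_def
proof (rule conv_radius_geI_ex')
  fix r :: real assume r: "0 < r" "ereal r < 1"
  have "conv_radius (\<lambda>n. real n ^ Suc k) = 1"
  proof (rule conv_radius_ratio_limit[of _ 1])
    have "(\<lambda>n. (real n / real (Suc n)) ^ Suc k) \<longlonglongrightarrow> 1 ^ Suc k"
      by (intro tendsto_power LIMSEQ_n_over_Suc_n)
    then show "(\<lambda>n. norm (real n ^ Suc k) / norm (real (Suc n) ^ Suc k)) \<longlonglongrightarrow> 1"
      by (simp add: power_divide norm_power norm_mult abs_mult)
  qed (auto simp: eventually_at_top_linorder one_ereal_def intro!: exI[of _ 1])
  then have "summable (\<lambda>n. real n ^ Suc k * r ^ n)"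
    using r by (intro summable_in_conv_radius) auto
  then show "summable (\<lambda>n. fps_nth (sigma_fps k) n * of_real r ^ n)"
  proof (rule summable_comparison_test[rotated], intro exI[of _ 0] allI impI)
    fix n
    show "norm (fps_nth (sigma_fps k) n * of_real r ^ n) \<le> real n ^ Suc k * r ^ n"
      using norm_dsigma_le[of k n] r by (simp add: sigma_fps_def norm_mult norm_power mult_right_mono)
  qed
qed

lemma conv_radius_E2_fps: "fps_conv_radius E2_fps \<ge> 1"
  and conv_radius_E4_fps: "fps_conv_radius E4_fps \<ge> 1"
  and conv_radius_E6_fps: "fps_conv_radius E6_fps \<ge> 1"
proof -
  have *: "fps_conv_radius (numeral c * sigma_fps k) \<ge> 1" for c k
    using conv_radius_sigma_fps by (simp add: numeral_fps_const fps_conv_radius_cmult_left)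
  show "fps_conv_radius E2_fps \<ge> 1" "fps_conv_radius E4_fps \<ge> 1" "fps_conv_radius E6_fps \<ge> 1"
    unfolding E2_fps_def E4_fps_def E6_fps_def
    by (rule order_trans[OF _ fps_conv_radius_diff] order_trans[OF _ fps_conv_radius_add]; simp add: *)+
qed

lemma open_UHP [simp, intro]: "open UHP"
  unfolding UHP_def by (rule open_halfspace_Im_gt)

lemma norm_qexp: "norm (qexp z) = exp (- 2 * pi * Im z)"
  by (simp add: qexp_def)

lemma norm_qexp_less_1: "z \<in> UHP \<Longrightarrow> norm (qexp z) < 1"
  by (simp add: norm_qexp UHP_def)

lemma eval_sigma_fps:
  assumes "norm q < 1"
  shows "eval_fps (sigma_fps k) q = (\<Sum>n. dsigma k (Suc n) * q ^ Suc n)"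
proof -
  have "norm q < fps_conv_radius (sigma_fps k)"
    using assms by (intro less_le_trans[OF _ conv_radius_sigma_fps]) (simp add: one_ereal_def)
  from summable_fps[OF this] have "summable (\<lambda>n. dsigma k n * q ^ n)"
    by (simp add: sigma_fps_def)
  from suminf_split_head[OF this] show ?thesis
    by (simp add: eval_fps_def sigma_fps_def)
qed

lemma in_conv_radius:
  assumes "norm (q :: complex) < 1" "fps_conv_radius f \<ge> 1"
  shows "ereal (norm q) < fps_conv_radius f"
  using assms(1) by (intro less_le_trans[OF _ assms(2)]) (simp add: one_ereal_def)

lemma eval_numeral_sigma_fps:
  assumes "norm q < 1"
  shows "eval_fps (numeral c * sigma_fps k) q = numeral c * (\<Sum>n. dsigma k (Suc n) * q ^ Suc n)"
    "ereal (norm q) < fps_conv_radius (numeral c * sigma_fps k)"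
proof -
  have "fps_conv_radius (numeral c * sigma_fps k) \<ge> 1"
    using conv_radius_sigma_fps by (simp add: numeral_fps_const fps_conv_radius_cmult_left)
  then show "ereal (norm q) < fps_conv_radius (numeral c * sigma_fps k)" by (rule in_conv_radius[OF assms])
  show "eval_fps (numeral c * sigma_fps k) q = numeral c * (\<Sum>n. dsigma k (Suc n) * q ^ Suc n)"
    using in_conv_radius[OF assms conv_radius_sigma_fps]
    by (subst eval_fps_mult) (auto simp: eval_sigma_fps[OF assms])
qed

lemma eval_E_fps:
  assumes "z \<in> UHP"
  shows eval_E2_fps: "eval_fps E2_fps (qexp z) = Eis2 z"
    and eval_E4_fps: "eval_fps E4_fps (qexp z) = Eis4 z"
    and eval_E6_fps: "eval_fps E6_fps (qexp z) = Eis6 z"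
proof -
  note q = norm_qexp_less_1[OF assms]
  show "eval_fps E2_fps (qexp z) = Eis2 z" "eval_fps E4_fps (qexp z) = Eis4 z" "eval_fps E6_fps (qexp z) = Eis6 z"
    unfolding E2_fps_def E4_fps_def E6_fps_def Eis2_def Eis4_def Eis6_def
    by (simp_all add: eval_fps_diff eval_fps_add eval_numeral_sigma_fps[OF q] del: power_Suc)
qed

lemma qexp_deriv: "(qexp has_field_derivative 2 * of_real pi * \<i> * qexp z) (at z)"
  unfolding qexp_def by (auto intro!: derivative_eq_intros)

text \<open>The chain rule gives the factor 2 pi i q; \<open>fps_XD\<close> absorbs q and
  \<open>dq\<close> removes the rest, so \<open>dq\<close> on functions corresponds to
  \<open>fps_XD\<close> on series.\<close>

lemma has_field_derivative_eval_fps_qexp: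
  assumes "z \<in> UHP" "fps_conv_radius f \<ge> 1"
  shows "((\<lambda>z. eval_fps f (qexp z)) has_field_derivative 2 * of_real pi * \<i> * eval_fps (fps_XD f) (qexp z)) (at z)"
proof -
  note q = in_conv_radius[OF norm_qexp_less_1[OF assms(1)]]
  have "((\<lambda>z. eval_fps f (qexp z)) has_field_derivative eval_fps (fps_deriv f) (qexp z) * (2 * of_real pi * \<i> * qexp z)) (at z)"
    using DERIV_chain[OF has_field_derivative_eval_fps[OF q[OF assms(2)]] qexp_deriv]
    by (simp add: o_def)
  moreover have "eval_fps (fps_XD f) (qexp z) = qexp z * eval_fps (fps_deriv f) (qexp z)"
    using q[OF order_trans[OF assms(2) fps_conv_radius_deriv]]
    by (simp add: fps_XD_def eval_fps_mult)
  ultimately show ?thesis by (simp add: algebra_simps)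
qed

lemma has_field_derivative_Eis:
  assumes "z \<in> UHP"
  shows has_field_derivative_Eis2:
      "(Eis2 has_field_derivative 2 * of_real pi * \<i> * eval_fps (fps_XD E2_fps) (qexp z)) (at z)"
    and has_field_derivative_Eis4:
      "(Eis4 has_field_derivative 2 * of_real pi * \<i> * eval_fps (fps_XD E4_fps) (qexp z)) (at z)"
    and has_field_derivative_Eis6:
      "(Eis6 has_field_derivative 2 * of_real pi * \<i> * eval_fps (fps_XD E6_fps) (qexp z)) (at z)"
  by (rule has_field_derivative_transform_within_open[OF has_field_derivative_eval_fps_qexp[OF assms] open_UHP assms];
      simp add: eval_E_fps conv_radius_E2_fps conv_radius_E4_fps conv_radius_E6_fps)+

lemma holomorphic_Eis:
  shows holomorphic_Eis2: "Eis2 holomorphic_on UHP"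
    and holomorphic_Eis4: "Eis4 holomorphic_on UHP"
    and holomorphic_Eis6: "Eis6 holomorphic_on UHP"
  unfolding holomorphic_on_open[OF open_UHP] using has_field_derivative_Eis by blast+

lemma conv_radius_fps_XD: "fps_conv_radius f \<ge> 1 \<Longrightarrow> fps_conv_radius (fps_XD f) \<ge> 1" for f :: "complex fps"
  unfolding fps_XD_def o_def
  by (rule order_trans[OF _ fps_conv_radius_mult]) (auto intro: order_trans[OF _ fps_conv_radius_deriv])

lemma ramanujan:
  assumes "z \<in> UHP"
  shows ramanujan_E4: "dq Eis4 z = (Eis2 z * Eis4 z - Eis6 z) / 3"
    and ramanujan_E6: "dq Eis6 z = (Eis2 z * Eis6 z - Eis4 z ^ 2) / 2"
proof -
  note q = in_conv_radius[OF norm_qexp_less_1[OF assms]]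
  note r = q[OF conv_radius_E2_fps] q[OF conv_radius_E4_fps] q[OF conv_radius_E6_fps]
    q[OF conv_radius_fps_XD[OF conv_radius_E4_fps]] q[OF conv_radius_fps_XD[OF conv_radius_E6_fps]]
  \<comment> \<open>Convergence of the products, needed to evaluate their differences
    termwise.\<close>
  have m: "ereal (norm (qexp z)) < fps_conv_radius (f * g)"
    if "fps_conv_radius f \<ge> 1" "fps_conv_radius g \<ge> 1" for f g
    using that by (intro q order_trans[OF _ fps_conv_radius_mult]) auto
  note m = m[OF conv_radius_E2_fps conv_radius_E4_fps] m[OF conv_radius_E2_fps conv_radius_E6_fps]
    m[OF conv_radius_E4_fps conv_radius_E4_fps]
  have "3 * eval_fps (fps_XD E4_fps) (qexp z) = Eis2 z * Eis4 z - Eis6 z"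
    using arg_cong[OF ramanujan_E4_fps, of "\<lambda>f. eval_fps f (qexp z)"] r m
    by (simp add: eval_fps_mult eval_fps_diff eval_E_fps[OF assms])
  then show "dq Eis4 z = (Eis2 z * Eis4 z - Eis6 z) / 3"
    unfolding dq_def DERIV_imp_deriv[OF has_field_derivative_Eis4[OF assms]] by (simp add: field_simps)
  have "2 * eval_fps (fps_XD E6_fps) (qexp z) = Eis2 z * Eis6 z - Eis4 z ^ 2"
    using arg_cong[OF ramanujan_E6_fps, of "\<lambda>f. eval_fps f (qexp z)"] r m
    by (simp add: eval_fps_mult eval_fps_diff eval_E_fps[OF assms] power2_eq_square)
  then show "dq Eis6 z = (Eis2 z * Eis6 z - Eis4 z ^ 2) / 2"
    unfolding dq_def DERIV_imp_deriv[OF has_field_derivative_Eis6[OF assms]] by (simp add: field_simps)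
qed

section \<open>Commutation relations and spanning\<close>

lemma HsetI:
  assumes "finite {n. F n \<noteq> (\<lambda>_. 0)}" "\<And>n. F n holomorphic_on UHP" "\<And>n z. z \<notin> UHP \<Longrightarrow> F n z = 0"
  shows "F \<in> Hset"
  using assms by (simp add: Hset_def)

lemma HsetD:
  assumes "F \<in> Hset"
  shows "finite {n. F n \<noteq> (\<lambda>_. 0)}" "F n holomorphic_on UHP" "z \<notin> UHP \<Longrightarrow> F n z = 0"
  using assms by (simp_all add: Hset_def)

lemma Dop_zero [simp]: "Dop k (\<lambda>_. 0) = (\<lambda>_. 0)"
  by (simp add: Dop_def dq_def fun_eq_iff)

lemma holomorphic_Dop:
  assumes "f holomorphic_on UHP"
  shows "Dop k f holomorphic_on UHP"
  unfolding Dop_def[abs_def] dq_def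
  by (intro holomorphic_intros holomorphic_deriv[OF assms] assms holomorphic_Eis2) auto

text \<open>All three generators apply some \<open>L n\<close> in degree n and then shift by d, so
  the nonzero degrees of the image lie in a translate of those of \<open>F\<close>.\<close>

lemma Hset_shift:
  assumes F: "F \<in> Hset" and zero: "\<And>n z. z \<in> UHP \<Longrightarrow> F n = (\<lambda>_. 0) \<Longrightarrow> L n (F n) z = 0"
    and holo: "\<And>n f. f holomorphic_on UHP \<Longrightarrow> L n f holomorphic_on UHP"
  shows "(\<lambda>m z. if z \<in> UHP then L (m - d) (F (m - d)) z else 0) \<in> Hset"
proof (rule HsetI)
  have "{m. (\<lambda>z. if z \<in> UHP then L (m - d) (F (m - d)) z else 0) \<noteq> (\<lambda>_. 0)} \<subseteq>
      (\<lambda>n. n + d) ` {n. F n \<noteq> (\<lambda>_. 0)}"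
  proof
    fix m assume "m \<in> {m. (\<lambda>z. if z \<in> UHP then L (m - d) (F (m - d)) z else 0) \<noteq> (\<lambda>_. 0)}"
    then obtain z where "z \<in> UHP" "L (m - d) (F (m - d)) z \<noteq> 0" by (auto simp: fun_eq_iff split: if_splits)
    then have "F (m - d) \<noteq> (\<lambda>_. 0)" using zero by blast
    then show "m \<in> (\<lambda>n. n + d) ` {n. F n \<noteq> (\<lambda>_. 0)}"
      by (intro image_eqI[of _ _ "m - d"]) auto
  qed
  then show "finite {m. (\<lambda>z. if z \<in> UHP then L (m - d) (F (m - d)) z else 0) \<noteq> (\<lambda>_. 0)}"
    using HsetD(1)[OF F] finite_surj by blast
  show "(\<lambda>z. if z \<in> UHP then L (m - d) (F (m - d)) z else 0) holomorphic_on UHP" for m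
    using holo[OF HsetD(2)[OF F]] by (rule holomorphic_transform) auto
qed auto

text \<open>Common form of \<open>e4_op\<close> and \<open>e6_op\<close>, so that facts about both
  are proved once.\<close>

definition mul_op :: "(complex \<Rightarrow> complex) \<Rightarrow> real \<Rightarrow> gfun \<Rightarrow> gfun" where
  "mul_op g d F = (\<lambda>m z. if z \<in> UHP then g z * F (m - d) z else 0)"

lemma e4_op_eq_mul_op: "e4_op = mul_op Eis4 4"
  and e6_op_eq_mul_op: "e6_op = mul_op Eis6 6"
  by (simp_all add: e4_op_def e6_op_def mul_op_def fun_eq_iff)

lemma Hset_mul_op:
  assumes "g holomorphic_on UHP" "F \<in> Hset"
  shows "mul_op g d F \<in> Hset"
  unfolding mul_op_def by (rule Hset_shift[OF assms(2), where L = "\<lambda>n f z. g z * f z"])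
    (auto intro!: holomorphic_intros assms(1))

lemma Hset_delta: "F \<in> Hset \<Longrightarrow> delta_op F \<in> Hset"
  unfolding delta_op_def by (rule Hset_shift[where L = Dop]) (auto intro: holomorphic_Dop)

lemma Hset_e4: "F \<in> Hset \<Longrightarrow> e4_op F \<in> Hset"
  and Hset_e6: "F \<in> Hset \<Longrightarrow> e6_op F \<in> Hset"
  unfolding e4_op_eq_mul_op e6_op_eq_mul_op by (simp_all add: Hset_mul_op holomorphic_Eis4 holomorphic_Eis6)

lemma Hset_add:
  assumes "F \<in> Hset" "G \<in> Hset"
  shows "(\<lambda>m z. F m z + G m z) \<in> Hset"
proof (rule HsetI)
  have "{m. (\<lambda>z. F m z + G m z) \<noteq> (\<lambda>_. 0)} \<subseteq> {m. F m \<noteq> (\<lambda>_. 0)} \<union> {m. G m \<noteq> (\<lambda>_. 0)}"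
    by (auto simp: fun_eq_iff)
  then show "finite {m. (\<lambda>z. F m z + G m z) \<noteq> (\<lambda>_. 0)}"
    using HsetD(1)[OF assms(1)] HsetD(1)[OF assms(2)] by (meson finite_Un finite_subset)
qed (auto intro!: holomorphic_intros HsetD(2)[OF assms(1)] HsetD(2)[OF assms(2)]
    simp: HsetD(3)[OF assms(1)] HsetD(3)[OF assms(2)])

lemma Hset_smult:
  assumes "F \<in> Hset"
  shows "(\<lambda>m z. c * F m z) \<in> Hset"
proof (rule HsetI)
  have "{m. (\<lambda>z. c * F m z) \<noteq> (\<lambda>_. 0)} \<subseteq> {m. F m \<noteq> (\<lambda>_. 0)}"
    by (auto simp: fun_eq_iff)
  then show "finite {m. (\<lambda>z. c * F m z) \<noteq> (\<lambda>_. 0)}"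
    using HsetD(1)[OF assms] by (rule finite_subset)
qed (auto intro!: holomorphic_intros HsetD(2)[OF assms] simp: HsetD(3)[OF assms])

section \<open>The Leibniz rule and the commutation relations\<close>

lemma field_differentiable_UHP:
  "f holomorphic_on UHP \<Longrightarrow> z \<in> UHP \<Longrightarrow> f field_differentiable at z"
  by (rule holomorphic_on_imp_differentiable_at) auto

text \<open>\<open>deriv\<close> is local and \<open>UHP\<close> is open, so the normalisation to 0
  off \<open>UHP\<close> does not affect derivatives on it.\<close>

lemma Dop_cong_UHP:
  assumes "\<And>w. w \<in> UHP \<Longrightarrow> f w = g w" "z \<in> UHP"
  shows "Dop k f z = Dop k g z"
proof -
  have "deriv f z = deriv g z"
    by (rule deriv_cong_ev) (use assms eventually_nhds_in_open[OF open_UHP assms(2)] in \<open>auto elim: eventually_mono\<close>)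
  then show ?thesis using assms by (simp add: Dop_def dq_def)
qed

lemma Dop_add:
  assumes "f holomorphic_on UHP" "g holomorphic_on UHP" "z \<in> UHP"
  shows "Dop k (\<lambda>z. f z + g z) z = Dop k f z + Dop k g z"
  using assms by (simp add: Dop_def dq_def field_differentiable_UHP algebra_simps add_divide_distrib)

lemma Dop_smult:
  assumes "f holomorphic_on UHP" "z \<in> UHP"
  shows "Dop k (\<lambda>z. c * f z) z = c * Dop k f z"
  using assms by (simp add: Dop_def dq_def field_differentiable_UHP algebra_simps)

text \<open>The \<open>Eis2\<close> term is linear in the weight, so it splits along k + l and the
  Leibniz rule of the derivative carries over.\<close>

lemma Dop_mult:
  assumes "f holomorphic_on UHP" "g holomorphic_on UHP" "z \<in> UHP"
  shows "Dop (k + l) (\<lambda>z. f z * g z) z = Dop k f z * g z + f z * Dop l g z"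
  using assms by (simp add: Dop_def dq_def field_differentiable_UHP algebra_simps add_divide_distrib)

lemma Dop_Eis4: "z \<in> UHP \<Longrightarrow> Dop 4 Eis4 z = - Eis6 z / 3"
  and Dop_Eis6: "z \<in> UHP \<Longrightarrow> Dop 6 Eis6 z = - (Eis4 z ^ 2) / 2"
  by (simp_all add: Dop_def ramanujan field_simps)

lemma delta_add:
  assumes "F \<in> Hset" "G \<in> Hset"
  shows "delta_op (\<lambda>m z. F m z + G m z) = (\<lambda>m z. delta_op F m z + delta_op G m z)"
  using assms by (simp add: delta_op_def fun_eq_iff Dop_add HsetD(2))

lemma delta_smult:
  assumes "F \<in> Hset"
  shows "delta_op (\<lambda>m z. c * F m z) = (\<lambda>m z. c * delta_op F m z)"
  using assms by (simp add: delta_op_def fun_eq_iff Dop_smult HsetD(2))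

text \<open>The commutator of \<open>delta_op\<close> with multiplication by g in weight d is
  multiplication by \<open>Dop d g\<close>; for g = \<open>Eis4\<close> and g = \<open>Eis6\<close>,
  Ramanujan's identities make it free of \<open>Eis2\<close>.\<close>

lemma delta_mul_op:
  assumes "g holomorphic_on UHP" "F \<in> Hset" "z \<in> UHP"
  shows "delta_op (mul_op g d F) m z = mul_op g d (delta_op F) m z + Dop d g z * F (m - 2 - d) z"
proof -
  have index: "m - 2 - d = m - d - 2" by simp
  \<comment> \<open>The weight m - 2 is written as d + (m - 2 - d) so that g receives weight d in
    the Leibniz rule.\<close>
  have "delta_op (mul_op g d F) m z = Dop (d + (m - 2 - d)) (\<lambda>z. g z * F (m - 2 - d) z) z"
    using assms(3) by (auto simp: delta_op_def mul_op_def intro: Dop_cong_UHP)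
  also have "\<dots> = Dop d g z * F (m - 2 - d) z + g z * Dop (m - 2 - d) (F (m - 2 - d)) z"
    by (rule Dop_mult[OF assms(1) HsetD(2)[OF assms(2)] assms(3)])
  finally show ?thesis
    using assms(3) by (simp add: mul_op_def delta_op_def index)
qed

lemma delta_e4:
  assumes "F \<in> Hset"
  shows "delta_op (e4_op F) = (\<lambda>m z. e4_op (delta_op F) m z + (- 1 / 3) * e6_op F m z)"
proof (intro ext)
  fix m z
  show "delta_op (e4_op F) m z = e4_op (delta_op F) m z + (- 1 / 3) * e6_op F m z"
  proof (cases "z \<in> UHP")
    case True
    from delta_mul_op[OF holomorphic_Eis4 assms True, of 4 m] show ?thesis
      using True by (simp add: e4_op_eq_mul_op Dop_Eis4 e6_op_def)
  qed (simp add: delta_op_def e4_op_def e6_op_def)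
qed

lemma delta_e6:
  assumes "F \<in> Hset"
  shows "delta_op (e6_op F) = (\<lambda>m z. e6_op (delta_op F) m z + (- 1 / 2) * e4_op (e4_op F) m z)"
proof (intro ext)
  fix m z
  show "delta_op (e6_op F) m z = e6_op (delta_op F) m z + (- 1 / 2) * e4_op (e4_op F) m z"
  proof (cases "z \<in> UHP")
    case True
    from delta_mul_op[OF holomorphic_Eis6 assms True, of 6 m] show ?thesis
      using True by (simp add: e6_op_eq_mul_op Dop_Eis6 e4_op_def power2_eq_square)
  qed (simp add: delta_op_def e4_op_def e6_op_def)
qed

section \<open>The span of the monomials and its stability under the generators\<close>

lemma mul_op_add: "mul_op g d (\<lambda>m z. F m z + G m z) = (\<lambda>m z. mul_op g d F m z + mul_op g d G m z)"
  and mul_op_smult: "mul_op g d (\<lambda>m z. c * F m z) = (\<lambda>m z. c * mul_op g d F m z)"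
  by (simp_all add: mul_op_def fun_eq_iff algebra_simps)

lemma e4_e6_commute: "e4_op (e6_op F) = e6_op (e4_op F)"
  by (simp add: e4_op_def e6_op_def fun_eq_iff)

text \<open>Off \<open>Hset\<close> the operator \<open>delta_op\<close> need not be linear, since \<open>deriv\<close> may be a junk value there;
  hence the closure under agreement on \<open>Hset\<close>.\<close>
inductive_set mono_span :: "(gfun \<Rightarrow> gfun) set" where
  mono: "mono t \<in> mono_span"
| add: "A \<in> mono_span \<Longrightarrow> B \<in> mono_span \<Longrightarrow> (\<lambda>F m z. A F m z + B F m z) \<in> mono_span"
| smult: "A \<in> mono_span \<Longrightarrow> (\<lambda>F m z. c * A F m z) \<in> mono_span"
| cong: "A \<in> mono_span \<Longrightarrow> (\<And>F. F \<in> Hset \<Longrightarrow> B F = A F) \<Longrightarrow> B \<in> mono_span"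

lemma Hset_funpow: "(\<And>F. F \<in> Hset \<Longrightarrow> A F \<in> Hset) \<Longrightarrow> F \<in> Hset \<Longrightarrow> (A ^^ n) F \<in> Hset"
  by (induction n) auto

lemma Hset_mono: "F \<in> Hset \<Longrightarrow> mono t F \<in> Hset"
  by (cases t) (auto simp: mono_def intro!: Hset_funpow Hset_delta Hset_e4 Hset_e6)

lemma Hset_mono_span: "A \<in> mono_span \<Longrightarrow> F \<in> Hset \<Longrightarrow> A F \<in> Hset"
  by (induction arbitrary: F rule: mono_span.induct) (auto intro: Hset_mono Hset_add Hset_smult)

text \<open>Linearity of \<open>L\<close> on \<open>Hset\<close> reduces stability to monomials:
  elements of the span preserve \<open>Hset\<close>, and the rule \<open>cong\<close> absorbs the
  restriction to it.\<close>

lemma mono_span_left: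
  assumes A: "A \<in> mono_span" and mono: "\<And>t. L \<circ> mono t \<in> mono_span"
    and add: "\<And>F G. F \<in> Hset \<Longrightarrow> G \<in> Hset \<Longrightarrow> L (\<lambda>m z. F m z + G m z) = (\<lambda>m z. L F m z + L G m z)"
    and smult: "\<And>F c. F \<in> Hset \<Longrightarrow> L (\<lambda>m z. c * F m z) = (\<lambda>m z. c * L F m z)"
  shows "L \<circ> A \<in> mono_span"
  using A
proof (induction rule: mono_span.induct)
  case (add A B)
  show ?case
    by (rule mono_span.cong[OF mono_span.add[OF add.IH]]) (simp add: assms(3) Hset_mono_span add.hyps)
next
  case (smult A c)
  show ?case
    by (rule mono_span.cong[OF mono_span.smult[OF smult.IH]]) (simp add: assms(4) Hset_mono_span smult.hyps)
next
  case (cong A B)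
  then show ?case by (auto intro: mono_span.cong[OF cong.IH])
qed (rule mono)

lemma e4_mono: "e4_op \<circ> mono (i, j, k) = mono (Suc i, j, k)"
  by (simp add: mono_def fun_eq_iff)

lemma e6_mono: "e6_op \<circ> mono (i, j, k) = mono (i, Suc j, k)"
proof -
  have "e6_op ((e4_op ^^ i) F) = (e4_op ^^ i) (e6_op F)" for F
    by (induction i) (simp_all flip: e4_e6_commute)
  then show ?thesis by (simp add: mono_def fun_eq_iff)
qed

lemma e4_mono_span: "A \<in> mono_span \<Longrightarrow> e4_op \<circ> A \<in> mono_span"
proof (rule mono_span_left)
  show "e4_op \<circ> mono t \<in> mono_span" for t
    by (cases t) (simp add: e4_mono mono_span.mono)
qed (simp_all add: e4_op_eq_mul_op mul_op_add mul_op_smult)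

lemma e6_mono_span: "A \<in> mono_span \<Longrightarrow> e6_op \<circ> A \<in> mono_span"
proof (rule mono_span_left)
  show "e6_op \<circ> mono t \<in> mono_span" for t
    by (cases t) (simp add: e6_mono mono_span.mono)
qed (simp_all add: e6_op_eq_mul_op mul_op_add mul_op_smult)

text \<open>\<open>delta_op\<close> is moved to the right past the powers of \<open>e4_op\<close>,
  then those of \<open>e6_op\<close>. The correction terms stay in the span because it is stable
  under \<open>e4_op\<close> and \<open>e6_op\<close>; finally \<open>delta_op\<close> only raises
  k.\<close>

lemma delta_mono_span_mono: "delta_op \<circ> mono (i, j, k) \<in> mono_span"
proof (induction i)
  case 0
  show ?case
  proof (induction j)
    case 0
    have "delta_op \<circ> mono (0, 0, k) = mono (0, 0, Suc k)" by (simp add: mono_def fun_eq_iff)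
    then show ?case using mono_span.mono by metis
  next
    case (Suc j)
    have "(\<lambda>F m z. (e6_op \<circ> (delta_op \<circ> mono (0, j, k))) F m z +
        (- 1 / 2) * (e4_op \<circ> (e4_op \<circ> mono (0, j, k))) F m z) \<in> mono_span"
      by (intro mono_span.add mono_span.smult e4_mono_span e6_mono_span Suc mono_span.mono)
    then show ?case
      by (rule mono_span.cong) (simp add: e6_mono[symmetric] delta_e6 Hset_mono)
  qed
next
  case (Suc i)
  have "(\<lambda>F m z. (e4_op \<circ> (delta_op \<circ> mono (i, j, k))) F m z +
      (- 1 / 3) * (e6_op \<circ> mono (i, j, k)) F m z) \<in> mono_span"
    by (intro mono_span.add mono_span.smult e4_mono_span e6_mono_span Suc mono_span.mono)
  then show ?case
    by (rule mono_span.cong) (simp add: e4_mono[symmetric] delta_e4 Hset_mono)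
qed

lemma delta_mono_span: "A \<in> mono_span \<Longrightarrow> delta_op \<circ> A \<in> mono_span"
proof (rule mono_span_left)
  show "delta_op \<circ> mono t \<in> mono_span" for t
    by (cases t) (simp add: delta_mono_span_mono)
qed (auto simp: delta_add delta_smult)

lemma Ralg_comp_mono_span: "A \<in> Ralg \<Longrightarrow> B \<in> mono_span \<Longrightarrow> A \<circ> B \<in> mono_span"
proof (induction arbitrary: B rule: Ralg.induct)
  case (R_add A1 A2)
  have "(\<lambda>F m z. (A1 \<circ> B) F m z + (A2 \<circ> B) F m z) \<in> mono_span" using R_add by (intro mono_span.add)
  then show ?case by (simp add: o_def)
next
  case (R_smult A c)
  have "(\<lambda>F m z. c * (A \<circ> B) F m z) \<in> mono_span" using R_smult by (intro mono_span.smult)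
  then show ?case by (simp add: o_def)
next
  case (R_comp A1 A2)
  then show ?case by (simp add: o_assoc[symmetric])
qed (auto simp: delta_mono_span e4_mono_span e6_mono_span)

lemma Ralg_subset_mono_span: "Ralg \<subseteq> mono_span"
proof
  fix A assume "A \<in> Ralg"
  moreover have "mono (0, 0, 0) = id" by (simp add: mono_def)
  then have "id \<in> mono_span" using mono_span.mono by metis
  ultimately have "A \<circ> id \<in> mono_span" by (rule Ralg_comp_mono_span)
  then show "A \<in> mono_span" by simp
qed

lemma funpow_Ralg: "A \<in> Ralg \<Longrightarrow> A ^^ n \<in> Ralg"
  by (induction n) (auto intro: Ralg.intros simp: id_def[symmetric])

lemma mono_in_Ralg: "mono t \<in> Ralg"
  by (cases t) (auto simp: mono_def intro!: R_comp funpow_Ralg Ralg.intros)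

definition lincomb :: "(nat \<times> nat \<times> nat \<Rightarrow> complex) \<Rightarrow> gfun \<Rightarrow> gfun" where
  "lincomb c F = (\<lambda>m z. \<Sum>t\<in>{t. c t \<noteq> 0}. c t * mono t F m z)"

text \<open>Coefficients can cancel in a sum, so combinations are compared over a common finite
  superset of their supports.\<close>

lemma lincomb_superset:
  "finite T \<Longrightarrow> {t. c t \<noteq> 0} \<subseteq> T \<Longrightarrow> lincomb c F = (\<lambda>m z. \<Sum>t\<in>T. c t * mono t F m z)"
  unfolding lincomb_def by (intro ext sum.mono_neutral_left) auto

lemma mono_span_lincomb:
  "A \<in> mono_span \<Longrightarrow> \<exists>c. finite {t. c t \<noteq> 0} \<and> (\<forall>F\<in>Hset. A F = lincomb c F)"
proof (induction rule: mono_span.induct)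
  case (mono t)
  have "{s. (if s = t then 1 else 0 :: complex) \<noteq> 0} = {t}" by auto
  then show ?case by (intro exI[of _ "\<lambda>s. if s = t then 1 else 0"]) (auto simp: lincomb_def)
next
  case (add A B)
  then obtain c d where c: "finite {t. c t \<noteq> 0}" "\<And>F. F \<in> Hset \<Longrightarrow> A F = lincomb c F"
    and d: "finite {t. d t \<noteq> 0}" "\<And>F. F \<in> Hset \<Longrightarrow> B F = lincomb d F" by blast
  define T where "T = {t. c t \<noteq> 0} \<union> {t. d t \<noteq> 0}"
  have T: "finite T" "{t. c t \<noteq> 0} \<subseteq> T" "{t. d t \<noteq> 0} \<subseteq> T" "{t. c t + d t \<noteq> 0} \<subseteq> T"
    using c d by (auto simp: T_def)
  have "finite {t. c t + d t \<noteq> 0}" by (rule finite_subset[OF T(4,1)])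
  moreover have "(\<lambda>m z. A F m z + B F m z) = lincomb (\<lambda>t. c t + d t) F" if "F \<in> Hset" for F
    unfolding c(2)[OF that] d(2)[OF that] lincomb_superset[OF T(1,2)] lincomb_superset[OF T(1,3)]
      lincomb_superset[OF T(1,4)]
    by (simp add: sum.distrib algebra_simps)
  ultimately show ?case by (intro exI[of _ "\<lambda>t. c t + d t"]) blast
next
  case (smult A a)
  then obtain c where c: "finite {t. c t \<noteq> 0}" "\<And>F. F \<in> Hset \<Longrightarrow> A F = lincomb c F" by blast
  have sub: "{t. a * c t \<noteq> 0} \<subseteq> {t. c t \<noteq> 0}" by auto
  have "(\<lambda>m z. a * A F m z) = lincomb (\<lambda>t. a * c t) F" if "F \<in> Hset" for F
    unfolding c(2)[OF that] lincomb_superset[OF c(1) order_refl] lincomb_superset[OF c(1) sub]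
    by (simp add: sum_distrib_left algebra_simps)
  with finite_subset[OF sub c(1)] show ?case by (intro exI[of _ "\<lambda>t. a * c t"]) blast
qed auto

section \<open>Linear independence\<close>

text \<open>The element (f, 0) of H, normalised to 0 off \<open>UHP\<close>.\<close>

definition in_degree_0 :: "(complex \<Rightarrow> complex) \<Rightarrow> gfun" where
  "in_degree_0 f = (\<lambda>n z. if n = 0 \<and> z \<in> UHP then f z else 0)"

lemma in_degree_0_Hset:
  assumes "f holomorphic_on UHP"
  shows "in_degree_0 f \<in> Hset"
proof (rule HsetI)
  have "{n. in_degree_0 f n \<noteq> (\<lambda>_. 0)} \<subseteq> {0}" by (auto simp: in_degree_0_def fun_eq_iff)
  then show "finite {n. in_degree_0 f n \<noteq> (\<lambda>_. 0)}" by (rule finite_subset) simp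
  show "in_degree_0 f n holomorphic_on UHP" for n
  proof (cases "n = 0")
    case True
    show ?thesis by (rule holomorphic_transform[OF assms]) (simp add: True in_degree_0_def)
  next
    case False
    show ?thesis by (rule holomorphic_transform[of "\<lambda>_. 0"]) (simp_all add: False in_degree_0_def)
  qed
qed (simp add: in_degree_0_def)

text \<open>Each \<open>delta_op\<close> lowers the order of vanishing at w by exactly one and
  raises the degree by 2; \<open>h\<close> is the cofactor that does not vanish at w.\<close>

lemma delta_funpow_power:
  assumes "w \<in> UHP" "k \<le> K"
  shows "\<exists>h. h holomorphic_on UHP \<and> h w \<noteq> 0 \<and>
    (\<forall>m z. (delta_op ^^ k) (in_degree_0 (\<lambda>z. (z - w) ^ K)) m z =
      (if m = 2 * real k \<and> z \<in> UHP then (z - w) ^ (K - k) * h z else 0))"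
  using assms(2)
proof (induction k)
  case 0
  show ?case by (intro exI[of _ "\<lambda>_. 1"]) (auto simp: in_degree_0_def)
next
  case (Suc k)
  from Suc.IH[OF Suc_leD[OF Suc.prems]] obtain h where h: "h holomorphic_on UHP" "h w \<noteq> 0" and
    eq': "\<forall>m z. (delta_op ^^ k) (in_degree_0 (\<lambda>z. (z - w) ^ K)) m z =
      (if m = 2 * real k \<and> z \<in> UHP then (z - w) ^ (K - k) * h z else 0)"
    by blast
  then have eq: "(delta_op ^^ k) (in_degree_0 (\<lambda>z. (z - w) ^ K)) =
      (\<lambda>m z. if m = 2 * real k \<and> z \<in> UHP then (z - w) ^ (K - k) * h z else 0)"
    by (intro ext) simp
  define p where "p = K - Suc k"
  have p: "K - k = Suc p" using Suc.prems by (simp add: p_def)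
  \<comment> \<open>The Leibniz rule with \<open>(z - w) ^ p\<close> factored out. At w only the
    first summand remains, a nonzero multiple of \<open>h w\<close>.\<close>
  define g where "g = (\<lambda>z. of_nat (Suc p) / (2 * of_real pi * \<i>) * h z + (z - w) * Dop (2 * real k) h z)"
  have "g holomorphic_on UHP"
    unfolding g_def by (intro holomorphic_intros holomorphic_Dop h)
  moreover have "g w \<noteq> 0" using h by (simp add: g_def del: of_nat_Suc)
  moreover have "delta_op (\<lambda>m z. if m = 2 * real k \<and> z \<in> UHP then (z - w) ^ (K - k) * h z else 0) m z =
      (if m = 2 * real (Suc k) \<and> z \<in> UHP then (z - w) ^ (K - Suc k) * g z else 0)" for m z
  proof (cases "m = 2 * real (Suc k) \<and> z \<in> UHP")
    case True
    have "((\<lambda>z. (z - w) ^ Suc p) has_field_derivative of_nat (Suc p) * (z - w) ^ p) (at z)"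
      by (auto intro!: derivative_eq_intros simp del: power_Suc of_nat_Suc)
    then have D0: "Dop 0 (\<lambda>z. (z - w) ^ Suc p) z = of_nat (Suc p) * (z - w) ^ p / (2 * of_real pi * \<i>)"
      by (simp add: Dop_def dq_def DERIV_imp_deriv del: of_nat_Suc)
    \<comment> \<open>The power is given weight 0, so the \<open>Eis2\<close> term goes entirely to
      \<open>h\<close>.\<close>
    have "delta_op (\<lambda>m z. if m = 2 * real k \<and> z \<in> UHP then (z - w) ^ (K - k) * h z else 0) m z =
        Dop (0 + 2 * real k) (\<lambda>z. (z - w) ^ Suc p * h z) z"
      using True by (auto simp: delta_op_def p intro: Dop_cong_UHP)
    also have "\<dots> = Dop 0 (\<lambda>z. (z - w) ^ Suc p) z * h z + (z - w) ^ Suc p * Dop (2 * real k) h z"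
      using True by (intro Dop_mult h) (auto intro!: holomorphic_intros)
    also have "\<dots> = (z - w) ^ p * g z"
      unfolding D0 g_def by (simp add: algebra_simps)
    finally show ?thesis using True by (simp add: p_def)
  next
    case False
    then show ?thesis by (auto simp: delta_op_def)
  qed
  ultimately show ?case by (intro exI[of _ g]) (simp add: eq)
qed

lemma mul_op_funpow:
  "z \<in> UHP \<Longrightarrow> (mul_op g d ^^ i) F m z = g z ^ i * F (m - d * real i) z"
  by (induction i arbitrary: m) (auto simp: mul_op_def algebra_simps)

lemma mono_apply:
  "z \<in> UHP \<Longrightarrow> mono (i, j, k) F m z =
    Eis4 z ^ i * Eis6 z ^ j * (delta_op ^^ k) F (m - 4 * real i - 6 * real j) z"
  by (simp add: mono_def e4_op_eq_mul_op e6_op_eq_mul_op mul_op_funpow)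

text \<open>A nonzero polynomial has finitely many roots and hence none in some punctured
  neighbourhood of a, where \<open>u\<close> eventually lies.\<close>

lemma poly_eq_0_if_vanishes_at_limit:
  fixes p :: "complex poly"
  assumes "filterlim u (at a) F" "F \<noteq> bot" "\<forall>\<^sub>F t in F. poly p (u t) = 0"
  shows "p = 0"
proof (rule ccontr)
  assume "p \<noteq> 0"
  then have "finite {x. poly p x = 0}" by (rule poly_roots_finite)
  then have "open (- ({x. poly p x = 0} - {a}))"
    by (intro open_Compl finite_imp_closed) simp
  then have "\<forall>\<^sub>F x in at a. poly p x \<noteq> 0"
    unfolding eventually_at_topological by (intro exI[of _ "- ({x. poly p x = 0} - {a})"]) auto
  then have "\<forall>\<^sub>F t in F. poly p (u t) \<noteq> 0" using assms(1) by (rule eventually_compose_filterlim)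
  with assms(3) have "\<forall>\<^sub>F t in F. False" by eventually_elim simp
  with assms(2) show False by simp
qed

section \<open>The Eisenstein series at the cusp and their independence\<close>

lemma qexp_imaginary_axis: "filterlim (\<lambda>t. qexp (\<i> * of_real t)) (at 0) at_top"
proof -
  have "((\<lambda>t. exp (- 2 * pi * t)) \<longlongrightarrow> 0) at_top" by real_asymp
  then have "((\<lambda>t. norm (qexp (\<i> * of_real t))) \<longlongrightarrow> 0) at_top" by (simp add: norm_qexp)
  then have "((\<lambda>t. qexp (\<i> * of_real t)) \<longlongrightarrow> 0) at_top" by (rule tendsto_norm_zero_cancel)
  \<comment> \<open>\<open>qexp\<close> never vanishes, so 0 is approached through nonzero
    values.\<close>
  then show ?thesis by (simp add: filterlim_at qexp_def)
qed

lemma eventually_UHP_imaginary_axis: "\<forall>\<^sub>F t in at_top. \<i> * of_real t \<in> UHP"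
  using eventually_gt_at_top[of "0::real"] by eventually_elim (simp add: UHP_def)

lemma eval_fps_imaginary_axis:
  assumes "fps_conv_radius f \<ge> 1"
  shows "((\<lambda>t. eval_fps f (qexp (\<i> * of_real t))) \<longlongrightarrow> fps_nth f 0) at_top"
proof -
  have "isCont (eval_fps f) 0"
    using has_field_derivative_eval_fps[OF in_conv_radius[OF _ assms], of 0] by (auto intro: DERIV_isCont)
  then have "(eval_fps f \<longlongrightarrow> fps_nth f 0) (at 0)" by (simp add: isCont_def eval_fps_at_0)
  from filterlim_compose[OF this qexp_imaginary_axis] show ?thesis .
qed

lemma sigma_fps_nth_0 [simp]: "fps_nth (sigma_fps k) 0 = 0"
  and sigma_fps_nth_1 [simp]: "fps_nth (sigma_fps k) (Suc 0) = 1"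
  by (simp_all add: sigma_fps_def dsigma_def)

lemma Eis_imaginary_axis:
  shows Eis4_imaginary_axis: "((\<lambda>t. Eis4 (\<i> * of_real t)) \<longlongrightarrow> 1) at_top"
    and Eis6_imaginary_axis: "((\<lambda>t. Eis6 (\<i> * of_real t)) \<longlongrightarrow> 1) at_top"
proof -
  have *: "fps_nth E4_fps 0 = 1" "fps_nth E6_fps 0 = 1"
    by (simp_all add: E4_fps_def E6_fps_def)
  show "((\<lambda>t. Eis4 (\<i> * of_real t)) \<longlongrightarrow> 1) at_top"
    by (rule Lim_transform_eventually[OF eval_fps_imaginary_axis[OF conv_radius_E4_fps, unfolded *]
          eventually_mono[OF eventually_UHP_imaginary_axis eval_E4_fps]])
  show "((\<lambda>t. Eis6 (\<i> * of_real t)) \<longlongrightarrow> 1) at_top"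
    by (rule Lim_transform_eventually[OF eval_fps_imaginary_axis[OF conv_radius_E6_fps, unfolded *]
          eventually_mono[OF eventually_UHP_imaginary_axis eval_E6_fps]])
qed

text \<open>As a function of q, E_4^3 - E_6^2 has a simple zero at 0, with derivative 3 * 240 + 2 *
  504 = 1728, so it has no other zero nearby.\<close>

lemma Eis4_cubed_neq_Eis6_squared:
  "\<forall>\<^sub>F t in at_top. Eis4 (\<i> * of_real t) ^ 3 \<noteq> Eis6 (\<i> * of_real t) ^ 2"
proof -
  define f where "f = (\<lambda>q. eval_fps E4_fps q ^ 3 - eval_fps E6_fps q ^ 2)"
  have at_0: "eval_fps E4_fps 0 = 1" "eval_fps E6_fps 0 = 1"
    "eval_fps (fps_deriv E4_fps) 0 = 240" "eval_fps (fps_deriv E6_fps) 0 = - 504"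
    by (simp_all add: eval_fps_at_0 E4_fps_def E6_fps_def numeral_fps_const)
  have D: "(eval_fps E4_fps has_field_derivative 240) (at 0)" "(eval_fps E6_fps has_field_derivative - 504) (at 0)"
    using has_field_derivative_eval_fps[OF in_conv_radius[OF _ conv_radius_E4_fps], of 0 UNIV]
      has_field_derivative_eval_fps[OF in_conv_radius[OF _ conv_radius_E6_fps], of 0 UNIV]
    by (simp_all add: at_0)
  have "(f has_field_derivative 1728) (at 0)"
    unfolding f_def using DERIV_diff[OF DERIV_power[OF D(1), of 3] DERIV_power[OF D(2), of 2]] by (simp add: at_0)
  then have "((\<lambda>q. (f q - f 0) / (q - 0)) \<longlongrightarrow> 1728) (at 0)"
    by (simp add: has_field_derivative_iff)
  then have "\<forall>\<^sub>F q in at 0. (f q - f 0) / (q - 0) \<noteq> 0"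
    by (rule tendsto_imp_eventually_ne) simp
  then have "\<forall>\<^sub>F q in at 0. f q \<noteq> 0"
    by eventually_elim (auto simp: f_def at_0)
  then have "\<forall>\<^sub>F t in at_top. f (qexp (\<i> * of_real t)) \<noteq> 0"
    using qexp_imaginary_axis by (rule eventually_compose_filterlim)
  then show ?thesis using eventually_UHP_imaginary_axis
    by eventually_elim (simp add: f_def eval_E_fps)
qed

text \<open>With \<open>s = csqrt E4\<close>, the monomial \<open>E4 ^ i * E6 ^ j\<close> of weight \<open>4 i + 6 j = w\<close> is
  \<open>s ^ (w / 2) * (E6 / s ^ 3) ^ j\<close>, so a relation in a single weight is a polynomial equation for
  \<open>E6 / s ^ 3\<close>, which tends to 1 at the cusp without being equal to 1.\<close>
lemma Eis4_Eis6_independent: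
  fixes a :: "nat \<times> nat \<Rightarrow> complex"
  assumes S: "finite S" "\<And>i j. (i, j) \<in> S \<Longrightarrow> 4 * i + 6 * j = w"
    and zero: "\<And>z. z \<in> UHP \<Longrightarrow> (\<Sum>(i, j)\<in>S. a (i, j) * (Eis4 z ^ i * Eis6 z ^ j)) = 0"
    and "s \<in> S"
  shows "a s = 0"
proof -
  define p where "p = (\<Sum>(i, j)\<in>S. monom (a (i, j)) j)"
  define r where "r = (\<lambda>t. csqrt (Eis4 (\<i> * of_real t)))"
  define u where "u = (\<lambda>t. Eis6 (\<i> * of_real t) / r t ^ 3)"
  \<comment> \<open>The limit 1 of \<open>Eis4\<close> lies off the branch cut of
    \<open>csqrt\<close>.\<close>
  have "(r \<longlongrightarrow> csqrt 1) at_top"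
    unfolding r_def by (rule tendsto_compose[OF _ Eis4_imaginary_axis])
      (use continuous_at_csqrt[of 1] in \<open>simp add: isCont_def complex_nonpos_Reals_iff\<close>)
  then have r: "(r \<longlongrightarrow> 1) at_top" by simp
  have nz: "\<forall>\<^sub>F t in at_top. r t \<noteq> 0" using r by (rule tendsto_imp_eventually_ne) simp
  have r2: "r t ^ 2 = Eis4 (\<i> * of_real t)" for t by (simp add: r_def)
  have "(u \<longlongrightarrow> 1 / 1 ^ 3) at_top"
    unfolding u_def by (intro tendsto_intros Eis6_imaginary_axis r) simp
  moreover have "\<forall>\<^sub>F t in at_top. u t \<noteq> 1"
    using nz Eis4_cubed_neq_Eis6_squared
  proof eventually_elim
    case (elim t)
    \<comment> \<open>If \<open>u t\<close> were 1, then \<open>Eis6\<close> would equal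
      \<open>r t ^ 3\<close> and its square would be \<open>Eis4\<close> cubed.\<close>
    have "r t ^ 6 = Eis4 (\<i> * of_real t) ^ 3" by (simp flip: r2 power_mult)
    with elim show ?case by (auto simp: u_def simp flip: power_mult)
  qed
  ultimately have u: "filterlim u (at 1) at_top" by (simp add: filterlim_at)
  have "\<forall>\<^sub>F t in at_top. poly p (u t) = 0"
    using nz eventually_UHP_imaginary_axis
  proof eventually_elim
    case (elim t)
    \<comment> \<open>Weights of the form 4 i + 6 j are even, so the division is exact whenever it
      is used.\<close>
    define v where "v = w div 2"
    have "r t ^ v * poly p (u t) = (\<Sum>(i, j)\<in>S. a (i, j) * (Eis4 (\<i> * of_real t) ^ i * Eis6 (\<i> * of_real t) ^ j))"
      unfolding p_def poly_sum sum_distrib_left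
    proof (rule sum.cong[OF refl], clarify)
      fix i j assume "(i, j) \<in> S"
      from S(2)[OF this] have v: "v = 2 * i + 3 * j" unfolding v_def by linarith
      have "r t ^ v * u t ^ j = Eis4 (\<i> * of_real t) ^ i * Eis6 (\<i> * of_real t) ^ j"
        using elim(1) by (simp add: v u_def power_add power_mult power_divide r2)
      then show "r t ^ v * poly (monom (a (i, j)) j) (u t) =
          a (i, j) * (Eis4 (\<i> * of_real t) ^ i * Eis6 (\<i> * of_real t) ^ j)"
        by (simp add: poly_monom algebra_simps)
    qed
    with zero[OF elim(2)] elim(1) show ?case by simp
  qed
  then have p: "p = 0"
    by (rule poly_eq_0_if_vanishes_at_limit[OF u trivial_limit_at_top_linorder])
  obtain i j where s: "s = (i, j)" by (cases s)
  \<comment> \<open>In a fixed weight j determines i, so no two monomials contribute to the same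
    coefficient of \<open>p\<close>.\<close>
  have "coeff p j = (\<Sum>t\<in>S. if t = s then a t else 0)"
    unfolding p_def coeff_sum
  proof (rule sum.cong[OF refl], clarify)
    fix i' j' assume "(i', j') \<in> S"
    from S(2)[OF this] S(2)[of i j] \<open>s \<in> S\<close> s
    have "j' = j \<longleftrightarrow> (i', j') = s" by auto
    then show "coeff (monom (a (i', j')) j') j = (if (i', j') = s then a (i', j') else 0)" by simp
  qed
  also have "\<dots> = a s" using S(1) \<open>s \<in> S\<close> by simp
  finally show ?thesis using p by simp
qed

lemma lincomb_eq_0D:
  assumes fin: "finite {t. c t \<noteq> 0}" and zero: "\<And>F. F \<in> Hset \<Longrightarrow> lincomb c F = (\<lambda>m z. 0)"
  shows "c t = 0"
proof (rule ccontr)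
  assume "c t \<noteq> 0"
  define deg where "deg = (\<lambda>t :: nat \<times> nat \<times> nat. snd (snd t))"
  define T where "T = {t. c t \<noteq> 0}"
  have T: "finite T" "T \<noteq> {}" unfolding T_def using fin \<open>c t \<noteq> 0\<close> by blast+
  define K where "K = Max (deg ` T)"
  have "K \<in> deg ` T" unfolding K_def using T by (intro Max_in) auto
  then obtain i0 j0 where top: "c (i0, j0, K) \<noteq> 0" by (auto simp: deg_def T_def)
  have le: "k \<le> K" if "c (i, j, k) \<noteq> 0" for i j k
    unfolding K_def using that T by (intro Max_ge) (auto simp: T_def deg_def intro!: image_eqI[of _ _ "(i, j, k)"])
  define w where "w = 4 * i0 + 6 * j0"
  define S where "S = {(i, j). c (i, j, K) \<noteq> 0 \<and> 4 * i + 6 * j = w}"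
  have inj: "inj_on (\<lambda>(i, j). (i, j, K)) S" by (auto simp: inj_on_def)
  have img: "(\<lambda>(i, j). (i, j, K)) ` S \<subseteq> T" by (auto simp: S_def T_def)
  have "finite S" by (rule finite_imageD[OF finite_subset[OF img T(1)] inj])
  have "(case (i0, j0) of (i, j) \<Rightarrow> c (i, j, K)) = 0"
  proof (rule Eis4_Eis6_independent[OF \<open>finite S\<close>, where w = w and a = "\<lambda>(i, j). c (i, j, K)"])
    fix z assume z: "z \<in> UHP"
    \<comment> \<open>The test element is centred at the point z where the relation is
      evaluated.\<close>
    define F where "F = in_degree_0 (\<lambda>x. (x - z) ^ K)"
    have F: "F \<in> Hset" unfolding F_def by (intro in_degree_0_Hset holomorphic_intros)
    have lower: "(delta_op ^^ k) F m z = 0" if "k < K" for k m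
      using delta_funpow_power[OF z, of k K] that by (auto simp: F_def)
    \<comment> \<open>For k = K the power of the vanishing factor is \<open>0 ^ 0 = 1\<close>, so
      only the nonzero cofactor remains.\<close>
    obtain h0 where h0: "h0 \<noteq> 0" "\<And>m. (delta_op ^^ K) F m z = (if m = 2 * real K then h0 else 0)"
      using delta_funpow_power[OF z, of K K] z by (auto simp: F_def)
    \<comment> \<open>\<open>mono (i, j, K)\<close> raises degree 0 to 4 i + 6 j + 2 K, so
      evaluation in degree \<open>m\<close> singles out the weight \<open>w\<close>.\<close>
    define m where "m = real w + 2 * real K"
    have "0 = (\<Sum>t\<in>T. c t * mono t F m z)"
      using zero[OF F] by (simp add: lincomb_def T_def fun_eq_iff)
    also have "\<dots> = (\<Sum>t\<in>(\<lambda>(i, j). (i, j, K)) ` S. c t * mono t F m z)"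
    proof (rule sum.mono_neutral_right[OF T(1) img], clarify)
      fix i j k assume t: "(i, j, k) \<in> T" "(i, j, k) \<notin> (\<lambda>(i, j). (i, j, K)) ` S"
      show "c (i, j, k) * mono (i, j, k) F m z = 0"
      proof (cases "k = K")
        case True
        with t have "4 * i + 6 * j \<noteq> w" by (auto simp: S_def T_def)
        then have "m - 4 * real i - 6 * real j \<noteq> 2 * real K" by (auto simp: m_def)
        then show ?thesis by (simp add: mono_apply[OF z] True h0)
      next
        case False
        then have "k < K" using le[of i j k] t by (auto simp: T_def)
        then show ?thesis by (simp add: mono_apply[OF z] lower)
      qed
    qed
    also have "\<dots> = (\<Sum>(i, j)\<in>S. c (i, j, K) * mono (i, j, K) F m z)"
      by (subst sum.reindex[OF inj]) (simp add: o_def case_prod_unfold)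
    also have "\<dots> = (\<Sum>(i, j)\<in>S. h0 * (c (i, j, K) * (Eis4 z ^ i * Eis6 z ^ j)))"
      by (rule sum.cong) (auto simp: S_def m_def mono_apply[OF z] h0 algebra_simps)
    also have "\<dots> = h0 * (\<Sum>(i, j)\<in>S. c (i, j, K) * (Eis4 z ^ i * Eis6 z ^ j))"
      by (simp add: sum_distrib_left case_prod_unfold)
    finally show "(\<Sum>(i, j)\<in>S. (case (i, j) of (i, j) \<Rightarrow> c (i, j, K)) * (Eis4 z ^ i * Eis6 z ^ j)) = 0"
      using h0(1) by simp
  next
    show "(i0, j0) \<in> S" using top by (simp add: S_def w_def)
  qed (auto simp: S_def)
  with top show False by simp
qed

theorem theorem3p3:
  shows "(\<forall>t. mono t \<in> Ralg) \<and>
    (\<forall>A\<in>Ralg. \<exists>c :: nat \<times> nat \<times> nat \<Rightarrow> complex. finite {t. c t \<noteq> 0} \<and>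
        (\<forall>F\<in>Hset. A F = (\<lambda>m z. \<Sum>t\<in>{t. c t \<noteq> 0}. c t * mono t F m z))) \<and>
    (\<forall>c :: nat \<times> nat \<times> nat \<Rightarrow> complex. finite {t. c t \<noteq> 0} \<and>
        (\<forall>F\<in>Hset. (\<lambda>m z. \<Sum>t\<in>{t. c t \<noteq> 0}. c t * mono t F m z) = (\<lambda>m z. 0))
      \<longrightarrow> (\<forall>t. c t = 0))"
  unfolding lincomb_def[symmetric]
  using mono_in_Ralg mono_span_lincomb Ralg_subset_mono_span lincomb_eq_0D by blast

end
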